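(* Let $G$ be a locally precompact group. The following statements are equivalent: (i) $G$ is hereditarily realcompact; (ii) $G$ has countable pseudocharacter, and $|G|<\mathfrak{m}$; (iii) $G$ has countable pseudocharacter, and $ip(G)<\mathfrak{m}$; (iv) $G$ admits a coarser homogeneous metrizable topology, and $|G|<\mathfrak{m}$; (v) $G$ admits a coarser homogeneous metrizable topology, and $ip(G)<\mathfrak{m}$.
   Context: All topological spaces and topological groups are assumed to be Tychonoff (in particular Hausdorff); groups need not be abelian. $\mathcal{N}(G)$ is the collection of open neighborhoods of the identity of $G$. A subset $X$ of a topological group $G$ is precompact if for every $U\in\mathcal{N}(G)$ there is a finite $S\subseteq X$ with $X\subseteq (SU)\cap(US)$. For an infinite cardinal $\tau$, $X$ is $\tau$-precompact if for every $U\in\mathcal{N}(G)$ there is $S\subseteq X$ with $|S|\le\tau$ and $X\subseteq (SU)\cap(US)$. The precompactness index $ip(X)$ is the least infinite cardinal $\tau$ such that $X$ is $\tau$-precompact. $G$ is locally precompact if some non-empty open subset of $G$ is precompact (equivalently, by Weil's theorem, $G$ is a dense topological subgroup of a locally compact group). A cardinal $\lambda$ is Ulam-measurable if there is a countably additive measure $\mu\colon\mathcal{P}(\lambda)\to\{0,1\}$ that is non-atomic (vanishes on singletons) with $\mu(\lambda)=1$. $\mathfrak{m}$ denotes the first Ulam-measurable cardinal (if it exists), and "$\lambda<\mathfrak{m}$" is used as shorthand for "$\lambda$ is not Ulam-measurable" (so it is true for every $\lambda$ if no Ulam-measurable cardinal exists). A space is realcompact if it is homeomorphic to a closed subspace of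 $\mathbb{R}^\lambda$ for some cardinal $\lambda$, and hereditarily realcompact if every subspace of it is realcompact. A space has countable pseudocharacter if every singleton is a $G_\delta$-set (a countable intersection of open sets). A topology is homogeneous if its group of self-homeomorphisms acts transitively on points; a coarser topology on $G$ here is just a topology on the underlying set, contained in the given one. *)

theory Defs
  imports "HOL-Analysis.Analysis"
begin

unbundle cardinal_syntax

text \<open>
  A topological group is a type of class \<open>topological_group_add\<close> together with \<open>t2_space\<close>; Hausdorff
  topological groups are Tychonoff. The group is written additively, but \<open>group_add\<close> does not assume
  commutativity, so \<open>S + U\<close> and \<open>U + S\<close> are different sets in general.
  Cardinals are the well-order relations of the library: \<open>card_of A\<close>, written \<open>|A|\<close>, is the
  cardinality of \<open>A\<close>, the predicate \<open>Cinfinite\<close> singles out the infinite cardinals, and \<open>\<le>o\<close>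
  compares cardinals that may live on different types.
\<close>

section \<open>Precompactness in topological groups\<close>

definition precompact :: "'a::topological_group_add set \<Rightarrow> bool" where
  "precompact X \<longleftrightarrow>
     (\<forall>U. open U \<and> 0 \<in> U \<longrightarrow> (\<exists>S\<subseteq>X. finite S \<and> X \<subseteq> (S + U) \<inter> (U + S)))"

definition card_precompact :: "'t rel \<Rightarrow> 'a::topological_group_add set \<Rightarrow> bool" where
  "card_precompact \<tau> X \<longleftrightarrow>
     (\<forall>U. open U \<and> 0 \<in> U \<longrightarrow> (\<exists>S\<subseteq>X. |S| \<le>o \<tau> \<and> X \<subseteq> (S + U) \<inter> (U + S)))"

text \<open>
  The type \<open>'a + nat\<close> carries a cardinal that is both infinite and at least \<open>|X|\<close>, so it is large
  enough to carry the least infinite cardinal in question. Lemma \<open>precompactness_index\<close> below shows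
  that the cardinal chosen here is also least among the cardinals on all other types.
\<close>

definition precompactness_index :: "'a::topological_group_add set \<Rightarrow> ('a + nat) rel" where
  "precompactness_index X =
     (SOME \<tau>. Cinfinite \<tau> \<and> card_precompact \<tau> X \<and>
        (\<forall>\<tau>' :: ('a + nat) rel. Cinfinite \<tau>' \<and> card_precompact \<tau>' X \<longrightarrow> \<tau> \<le>o \<tau>'))"

definition locally_precompact :: "'a::topological_group_add itself \<Rightarrow> bool" where
  "locally_precompact _ \<longleftrightarrow> (\<exists>U :: 'a set. open U \<and> U \<noteq> {} \<and> precompact U)"

lemma card_precompact_mono:
  fixes X :: "'b::topological_group_add set"
  assumes "card_precompact r X" "r \<le>o r'"
  shows "card_precompact r' X"
  unfolding card_precompact_def
proof (intro allI impI)
  fix U :: "'b set"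
  assume "open U \<and> 0 \<in> U"
  then obtain S where "S \<subseteq> X" "|S| \<le>o r" "X \<subseteq> (S + U) \<inter> (U + S)"
    using assms(1) unfolding card_precompact_def by blast
  with ordLeq_transitive[OF _ assms(2)] show "\<exists>S\<subseteq>X. |S| \<le>o r' \<and> X \<subseteq> (S + U) \<inter> (U + S)"
    by blast
qed

lemma card_precompact_card_of:
  fixes X :: "'a::topological_group_add set"
  shows "|X| \<le>o r \<Longrightarrow> card_precompact r X"
  unfolding card_precompact_def
proof (intro allI impI exI[of _ X] conjI subset_refl)
  fix U :: "'a set"
  assume "open U \<and> 0 \<in> U"
  then show "X \<subseteq> (X + U) \<inter> (U + X)"
    using set_plus_intro[of _ X 0 U] set_plus_intro[of 0 U _ X] by auto
qed

lemma precompactness_index: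
  fixes X :: "'a::topological_group_add set"
  shows "Cinfinite (precompactness_index X)"
    and "card_precompact (precompactness_index X) X"
    and "Cinfinite \<tau> \<Longrightarrow> card_precompact \<tau> X \<Longrightarrow> precompactness_index X \<le>o \<tau>"
proof -
  let ?P = "\<lambda>\<tau> :: ('a + nat) rel. Cinfinite \<tau> \<and> card_precompact \<tau> X"
  let ?u = "|UNIV :: ('a + nat) set|"
  have inf: "infinite (UNIV :: ('a + nat) set)"
    by (simp add: finite_Plus_UNIV_iff)
  have X_le: "|X| \<le>o ?u"
    by (rule card_of_ordLeqI[of Inl]) auto
  have u: "?P ?u"
    using inf card_precompact_card_of[OF X_le]
    unfolding cinfinite_def Field_card_of by (intro conjI card_of_card_order_on)
  have "\<exists>\<tau>\<in>Collect ?P. \<forall>\<tau>'\<in>Collect ?P. \<tau> \<le>o \<tau>'"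
  proof (rule exists_minim_Card_order)
    from u have "?u \<in> Collect ?P" by (rule CollectI)
    then show "Collect ?P \<noteq> {}" by (rule ex_in_conv[THEN iffD1, OF exI])
    show "\<forall>\<tau>\<in>Collect ?P. Card_order \<tau>" by (rule ballI) (drule CollectD, elim conjE)
  qed
  then have "\<exists>\<tau> :: ('a + nat) rel. Cinfinite \<tau> \<and> card_precompact \<tau> X \<and>
        (\<forall>\<tau>' :: ('a + nat) rel. Cinfinite \<tau>' \<and> card_precompact \<tau>' X \<longrightarrow> \<tau> \<le>o \<tau>')"
    unfolding Bex_def Ball_def mem_Collect_eq by (simp only: conj_assoc)
  from someI_ex[OF this, folded precompactness_index_def]
  have ip: "Cinfinite (precompactness_index X)" "card_precompact (precompactness_index X) X"
    and least: "\<And>\<tau>'. ?P \<tau>' \<Longrightarrow> precompactness_index X \<le>o \<tau>'"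
    by simp_all
  show "Cinfinite (precompactness_index X)" "card_precompact (precompactness_index X) X"
    by (fact ip)+
  show "precompactness_index X \<le>o \<tau>" if \<tau>: "Cinfinite \<tau>" "card_precompact \<tau> X"
  proof (rule ccontr)
    assume "\<not> precompactness_index X \<le>o \<tau>"
    then have "\<tau> \<le>o precompactness_index X"
      using ordLeq_total[of \<tau> "precompactness_index X"] \<tau> ip
      unfolding card_order_on_def by blast
    also have "precompactness_index X \<le>o ?u"
      by (rule least[OF u])
    finally have "|Field \<tau>| \<le>o ?u"
      using ordIso_ordLeq_trans[OF card_of_Field_ordIso] \<tau> by blast
    then obtain f :: "_ \<Rightarrow> 'a + nat" where f: "inj_on f (Field \<tau>)"
      using card_of_ordLeq[of "Field \<tau>" "UNIV :: ('a + nat) set"] by blast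
    have img: "|Field \<tau>| \<le>o |f ` Field \<tau>|"
      by (rule card_of_ordLeqI[OF f]) blast
    have field: "(card_of (Field \<tau>), \<tau>) \<in> ordIso"
      using \<tau> by (intro card_of_Field_ordIso) blast
    have le: "\<tau> \<le>o |f ` Field \<tau>|" "|f ` Field \<tau>| \<le>o \<tau>"
      by (rule ordIso_ordLeq_trans[OF ordIso_symmetric[OF field] img])
         (rule ordLeq_ordIso_trans[OF card_of_image field])
    have "?P |f ` Field \<tau>|"
      using cinfinite_mono[OF le(1)] card_precompact_mono[OF \<tau>(2) le(1)] \<tau>(1)
        card_of_Card_order[of "f ` Field \<tau>"] by blast
    then have "precompactness_index X \<le>o |f ` Field \<tau>|"
      by (rule least)
    then have "precompactness_index X \<le>o \<tau>"
      using le(2) by (rule ordLeq_transitive)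
    with \<open>\<not> precompactness_index X \<le>o \<tau>\<close> show False ..
  qed
qed

section \<open>Ulam-measurable cardinals\<close>

definition ulam_measurable :: "'b rel \<Rightarrow> bool" where
  "ulam_measurable r \<longleftrightarrow>
     (\<exists>M :: 'b measure. space M = Field r \<and> sets M = Pow (Field r) \<and>
        (\<forall>A\<subseteq>Field r. emeasure M A \<in> {0, 1}) \<and>
        (\<forall>x\<in>Field r. emeasure M {x} = 0) \<and> emeasure M (Field r) = 1)"

text \<open>
  Ulam-measurability passes to larger cardinals. This justifies reading \<open>\<not> ulam_measurable r\<close> as
  ``\<open>r\<close> is smaller than the first Ulam-measurable cardinal''.
\<close>

lemma ulam_measurable_mono:
  assumes "ulam_measurable r" "Card_order r" "Card_order r'" "r \<le>o r'"
  shows "ulam_measurable r'"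
proof -
  obtain M where "space M = Field r \<and> sets M = Pow (Field r) \<and>
      (\<forall>A\<subseteq>Field r. emeasure M A \<in> {0, 1}) \<and>
      (\<forall>x\<in>Field r. emeasure M {x} = 0) \<and> emeasure M (Field r) = 1"
    using assms(1) unfolding ulam_measurable_def ..
  then have M: "space M = Field r" "sets M = Pow (Field r)"
    "\<And>A. A \<subseteq> Field r \<Longrightarrow> emeasure M A \<in> {0, 1}"
    "\<And>x. x \<in> Field r \<Longrightarrow> emeasure M {x} = 0" "emeasure M (Field r) = 1"
    by simp_all
  have "|Field r| \<le>o |Field r'|"
    using assms(4) by (rule card_of_mono2)
  then obtain f where f: "inj_on f (Field r)" "f ` Field r \<subseteq> Field r'"
    using card_of_ordLeq[of "Field r" "Field r'"] by blast
  let ?N = "distr M (count_space (Field r')) f"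
  have meas: "f \<in> measurable M (count_space (Field r'))"
    using f M by (auto simp: measurable_def)
  have N: "emeasure ?N A = emeasure M (f -` A \<inter> Field r)" if "A \<subseteq> Field r'" for A
    using emeasure_distr[OF meas, of A] that M by simp
  have "emeasure ?N {y} = 0" if "y \<in> Field r'" for y
  proof (cases "y \<in> f ` Field r")
    case True
    then obtain x where "x \<in> Field r" "y = f x" by blast
    then have "f -` {y} \<inter> Field r = {x}" using f by (auto dest: inj_onD)
    then show ?thesis using N[of "{y}"] that M(4) \<open>x \<in> Field r\<close> by simp
  next
    case False
    then have "f -` {y} \<inter> Field r = {}" by blast
    then show ?thesis using N[of "{y}"] that by simp
  qed
  moreover have "f -` Field r' \<inter> Field r = Field r" using f by blast
  ultimately show ?thesis
    unfolding ulam_measurable_def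
  proof (intro exI[of _ ?N] conjI allI impI ballI)
    show "emeasure ?N A \<in> {0, 1}" if "A \<subseteq> Field r'" for A
      unfolding N[OF that] by (rule M(3)) blast
    show "emeasure ?N (Field r') = 1"
      using N[OF subset_refl] \<open>f -` Field r' \<inter> Field r = Field r\<close> M(5) by simp
  qed simp_all
qed

section \<open>Topological notions\<close>

text \<open>
  Closed subspaces of powers of the real line. Index sets are taken inside \<open>'a \<Rightarrow> real\<close>; by lemma
  \<open>realcompact_spaceI\<close> below, a closed embedding into a power with an index set of any other type
  gives one of this form, since repeated coordinate functions can be dropped.
\<close>

definition realcompact_space :: "'a topology \<Rightarrow> bool" where
  "realcompact_space X \<longleftrightarrow>
     (\<exists>(I :: ('a \<Rightarrow> real) set) C. closedin (powertop_real I) C \<and>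
        X homeomorphic_space subtopology (powertop_real I) C)"

definition hereditarily_realcompact_space :: "'a topology \<Rightarrow> bool" where
  "hereditarily_realcompact_space X \<longleftrightarrow>
     (\<forall>S\<subseteq>topspace X. realcompact_space (subtopology X S))"

definition countable_pseudocharacter :: "'a topology \<Rightarrow> bool" where
  "countable_pseudocharacter X \<longleftrightarrow> (\<forall>x\<in>topspace X. gdelta_in X {x})"

definition homogeneous_space :: "'a topology \<Rightarrow> bool" where
  "homogeneous_space X \<longleftrightarrow>
     (\<forall>x\<in>topspace X. \<forall>y\<in>topspace X. \<exists>f. homeomorphic_map X X f \<and> f x = y)"

definition coarser_topology :: "'a topology \<Rightarrow> 'a topology \<Rightarrow> bool" where
  "coarser_topology T X \<longleftrightarrow> topspace T = topspace X \<and> (\<forall>U. openin T U \<longrightarrow> openin X U)"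

lemma realcompact_spaceI:
  fixes X :: "'a topology" and J :: "'i set"
  assumes C: "closedin (powertop_real J) C"
    and X: "X homeomorphic_space subtopology (powertop_real J) C"
  shows "realcompact_space X"
proof -
  obtain e d where ed: "homeomorphic_maps X (subtopology (powertop_real J) C) e d"
    using X unfolding homeomorphic_space_def by blast
  define F where "F j = (\<lambda>x. if x \<in> topspace X then e x j else 0)" for j
  define I where "I = F ` J"
  define s where "s = inv_into J F"
  have s: "s g \<in> J" "F (s g) = g" if "g \<in> I" for g
    using that unfolding I_def s_def by (auto intro: inv_into_into f_inv_into_f)
  define q where "q z = (\<lambda>g\<in>I. z (s g))" for z :: "'i \<Rightarrow> real"
  define p where "p y = (\<lambda>j\<in>J. y (F j))" for y :: "('a \<Rightarrow> real) \<Rightarrow> real"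
  have q_cont: "continuous_map (powertop_real J) (powertop_real I) q"
    unfolding q_def continuous_map_componentwise
    by (auto simp: s intro!: continuous_map_product_projection cong: restrict_cong)
  have p_cont: "continuous_map (powertop_real I) (powertop_real J) p"
    unfolding p_def continuous_map_componentwise
    by (auto simp: I_def intro!: continuous_map_product_projection)
  have qp: "q (p y) = y" if "y \<in> topspace (powertop_real I)" for y
    using that by (auto simp: q_def p_def s PiE_def extensional_def)
  have C_sub: "C \<subseteq> topspace (powertop_real J)"
    using C by (rule closedin_subset)
  have pq: "p (q z) = z" if z: "z \<in> C" for z
  proof
    fix j
    have z_top: "z \<in> topspace (subtopology (powertop_real J) C)"
      using z C_sub by auto
    have d: "d z \<in> topspace X" and ez: "e (d z) = z"
      using ed z_top by (auto simp: homeomorphic_maps_def continuous_map_def)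
    have z_F: "z j = F j (d z)" for j
      using d ez by (simp add: F_def)
    show "p (q z) j = z j"
    proof (cases "j \<in> J")
      case True
      then have "F j \<in> I" by (simp add: I_def)
      then show ?thesis
        using True z_F[of j] z_F[of "s (F j)"] s(2)[of "F j"] by (simp add: p_def q_def)
    next
      case False
      then show ?thesis using z C_sub by (auto simp: p_def PiE_def extensional_def)
    qed
  qed
  define D where "D = {y \<in> topspace (powertop_real I). p y \<in> C}"
  have D: "closedin (powertop_real I) D"
    unfolding D_def by (rule closedin_continuous_map_preimage[OF p_cont C])
  have qC: "q z \<in> D" if "z \<in> C" for z
    using that pq[OF that] C_sub unfolding D_def by (auto simp: q_def)
  have "homeomorphic_maps (subtopology (powertop_real J) C) (subtopology (powertop_real I) D) q p"
    unfolding homeomorphic_maps_def continuous_map_in_subtopology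
    using q_cont p_cont pq qp qC
    by (auto simp: D_def intro: continuous_map_from_subtopology)
  then have "X homeomorphic_space subtopology (powertop_real I) D"
    using homeomorphic_space_trans[OF X] homeomorphic_maps_imp_homeomorphic_space by blast
  with D show ?thesis
    unfolding realcompact_space_def by blast
qed

end

theory Submission
  imports Defs
begin

text \<open>
  Countable pseudocharacter yields a continuous left-invariant metric on \<open>G\<close>, hence a coarser
  metrizable topology that is homogeneous by left translations. With such a metric, a two-valued
  measure on \<open>G\<close> is determined by the translates on which it concentrates, so that it has an atom as
  soon as \<open>ip(G)\<close> is not Ulam-measurable.

  If \<open>|G|\<close> is not Ulam-measurable, a limit \<open>p\<close> of evaluations at points of \<open>Y \<subseteq> G\<close> defines a
  two-valued measure on each of the discrete families of a \<open>\<sigma>\<close>-discrete cover of \<open>Y\<close> by small sets;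
  the atoms of these measures shrink to a point of \<open>Y\<close> at which \<open>p\<close> is the evaluation, so that \<open>Y\<close> is
  realcompact. In the converse direction, a two-valued measure on a realcompact space assigns
  measure \<open>1\<close> to every neighbourhood of some point.

  Local precompactness makes \<open>G\<close> a Moscow space (the closure of an open set is a union of
  \<open>G\<^sub>\<delta>\<close>-sets), because disjoint families of open sets in a precompact open set are countable. If \<open>{x}\<close> is not a
  \<open>G\<^sub>\<delta>\<close>-set, every continuous real function on \<open>G - {x}\<close> therefore has a limit at \<open>x\<close>, and \<open>G - {x}\<close>
  is not realcompact.
\<close>

section \<open>Continuous seminorms on topological groups\<close>

lemma nbhd_add:
  fixes a b :: "'a::topological_monoid_add"
  assumes "open W" "a + b \<in> W"
  obtains A B where "open A" "open B" "a \<in> A" "b \<in> B" "\<And>x y. x \<in> A \<Longrightarrow> y \<in> B \<Longrightarrow> x + y \<in> W"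
proof -
  have "continuous_on UNIV (\<lambda>p::'a \<times> 'a. fst p + snd p)"
    by (intro continuous_intros)
  then have "open ((\<lambda>p::'a \<times> 'a. fst p + snd p) -` W)"
    using assms(1) by (simp add: continuous_on_open_vimage)
  then obtain A B where "open A" "open B" "(a, b) \<in> A \<times> B"
    "A \<times> B \<subseteq> (\<lambda>p::'a \<times> 'a. fst p + snd p) -` W"
    using assms(2) by (rule_tac open_prod_elim[of _ "(a, b)"]) auto
  then show ?thesis
    by (intro that[of A B]) auto
qed

lemma open_translation_vimage:
  fixes a :: "'a::topological_monoid_add"
  assumes "open W"
  shows "open {x. a + x \<in> W}" "open {x. x + a \<in> W}"
proof -
  have "continuous_on UNIV ((+) a)" "continuous_on UNIV (\<lambda>x. x + a)"
    by (intro continuous_intros)+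
  then show "open {x. a + x \<in> W}" "open {x. x + a \<in> W}"
    using assms by (simp_all add: continuous_on_open_vimage vimage_def)
qed

text \<open>Three summands are what cutting a chain into left part, middle term and right part
  requires; putting some of them to \<open>0\<close> yields fewer.\<close>

lemma nbhd_triple:
  fixes W :: "'a::topological_group_add set"
  assumes "open W" "0 \<in> W"
  obtains V where "open V" "0 \<in> V" "\<And>x. x \<in> V \<Longrightarrow> - x \<in> V"
    "\<And>x y z. x \<in> V \<Longrightarrow> y \<in> V \<Longrightarrow> z \<in> V \<Longrightarrow> x + y + z \<in> W"
proof -
  obtain A B where AB: "open A" "open B" "0 \<in> A" "0 \<in> B"
    "\<And>x y. x \<in> A \<Longrightarrow> y \<in> B \<Longrightarrow> x + y \<in> W"
    by (rule nbhd_add[of W 0 0]) (use assms in auto)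
  obtain C D where CD: "open C" "open D" "0 \<in> C" "0 \<in> D"
    "\<And>x y. x \<in> C \<Longrightarrow> y \<in> D \<Longrightarrow> x + y \<in> A"
    by (rule nbhd_add[of A 0 0]) (use AB in auto)
  define V0 where "V0 = B \<inter> C \<inter> D"
  have V0: "open V0" "0 \<in> V0"
    using AB CD by (auto simp: V0_def)
  have "continuous_on UNIV (uminus :: 'a \<Rightarrow> 'a)"
    by (intro continuous_intros)
  then have "open (uminus -` V0)"
    using V0 by (simp add: continuous_on_open_vimage)
  then have "open (V0 \<inter> uminus -` V0)" "0 \<in> V0 \<inter> uminus -` V0"
    using V0 by auto
  moreover have "- x \<in> V0 \<inter> uminus -` V0" if "x \<in> V0 \<inter> uminus -` V0" for x
    using that by simp
  moreover have "x + y + z \<in> W" if "x \<in> V0 \<inter> uminus -` V0" "y \<in> V0 \<inter> uminus -` V0"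
      "z \<in> V0 \<inter> uminus -` V0" for x y z
    using that AB(5) CD(5) by (auto simp: V0_def)
  ultimately show ?thesis
    by (rule that)
qed

text \<open>Take \<open>p\<close> to be the first entry after which the remaining cost is below
  \<open>b'\<close>. Before that point the remainder still costs at least \<open>b'\<close>, so the
  prefix costs less than \<open>b\<close>.\<close>

lemma sum_list_split_less:
  fixes c :: "'b \<Rightarrow> real"
  assumes "\<And>p. c p > 0" "ps \<noteq> []" "b > 0" "b' > 0" "sum_list (map c ps) < b + b'"
  shows "\<exists>xs p ys. ps = xs @ p # ys \<and> sum_list (map c xs) < b \<and> sum_list (map c ys) < b'"
  using assms(2-)
proof (induction ps arbitrary: b)
  case (Cons q ps)
  show ?case
  proof (cases "sum_list (map c ps) < b'")
    case True
    then show ?thesis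
      using Cons.prems by (intro exI[of _ "[]"] exI[of _ q] exI[of _ ps]) simp
  next
    case False
    then have "ps \<noteq> []" "b - c q > 0" "sum_list (map c ps) < (b - c q) + b'"
      using Cons.prems by auto
    with Cons obtain xs p ys where "ps = xs @ p # ys" "sum_list (map c xs) < b - c q"
      "sum_list (map c ys) < b'"
      by blast
    then show ?thesis
      by (intro exI[of _ "q # xs"] exI[of _ p] exI[of _ ys]) simp
  qed
qed simp

text \<open>
  The Birkhoff--Kakutani construction: \<open>N x\<close> is the infimum of \<open>\<Sum>i. 2 ^ - k\<^sub>i\<close> over all
  representations \<open>x = \<Sum>i. u\<^sub>i\<close> with \<open>u\<^sub>i \<in> V k\<^sub>i\<close>. Cutting such a sum into two parts of less than
  half the cost and one middle term shows that a cost below \<open>2 ^ - m\<close> forces \<open>x \<in> V m\<close>.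
\<close>

lemma chain_in_nbhd:
  fixes V :: "nat \<Rightarrow> 'a::monoid_add set"
  assumes zero: "\<And>n. 0 \<in> V n"
    and triple: "\<And>n x y z. x \<in> V (Suc n) \<Longrightarrow> y \<in> V (Suc n) \<Longrightarrow> z \<in> V (Suc n) \<Longrightarrow> x + y + z \<in> V n"
    and "\<forall>(k, u)\<in>set ps. u \<in> V k" "(\<Sum>(k, u)\<leftarrow>ps. (1/2::real) ^ k) < (1/2) ^ m"
  shows "sum_list (map snd ps) \<in> V m"
  using assms(3-)
proof (induction "length ps" arbitrary: ps m rule: less_induct)
  case less
  show ?case
  proof (cases "ps = []")
    case False
    have V: "V n \<subseteq> V m" if "m \<le> n" for m n
      using that
    proof (rule lift_Suc_antimono_le[rotated])
      show "V (Suc n) \<subseteq> V n" for n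
        using triple[of _ n 0 0] zero by auto
    qed
    let ?c = "\<lambda>(k, u :: 'a). (1/2::real) ^ k"
    have "sum_list (map ?c ps) < (1/2) ^ Suc m + (1/2) ^ Suc m"
      using less.prems(2) by simp
    from sum_list_split_less[OF _ False _ _ this] obtain xs p ys
      where ps: "ps = xs @ p # ys" and "sum_list (map ?c xs) < (1/2) ^ Suc m"
        "sum_list (map ?c ys) < (1/2) ^ Suc m"
      by auto
    then have "sum_list (map snd xs) \<in> V (Suc m)" "sum_list (map snd ys) \<in> V (Suc m)"
      using less.prems(1) by (auto intro!: less.hyps)
    \<comment> \<open>The cost of \<open>p\<close> alone is below \<open>(1/2) ^ m\<close>, so its
      index is strictly above \<open>m\<close>; this gains the level that \<open>triple\<close>
      consumes.\<close>
    moreover have "snd p \<in> V (Suc m)"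
    proof -
      have "sum_list (map ?c xs) \<ge> 0" "sum_list (map ?c ys) \<ge> 0"
        by (auto intro!: sum_list_nonneg)
      then have "m < fst p"
        using less.prems(2) power_decreasing[of "fst p" m "1/2::real"]
        by (cases "m < fst p") (auto simp: ps case_prod_beta simp del: power_decreasing_iff)
      then show ?thesis
        using less.prems(1) V[of "Suc m" "fst p"] by (auto simp: ps)
    qed
    ultimately show ?thesis
      using triple[of "sum_list (map snd xs)" m "snd p" "sum_list (map snd ys)"]
      by (simp add: ps add.assoc)
  qed (simp add: zero)
qed

text \<open>The point of these axioms is that \<open>N (- x + y)\<close> is a continuous
  left-invariant pseudometric.\<close>

locale continuous_seminorm =
  fixes N :: "'a::topological_group_add \<Rightarrow> real"
  assumes nonneg: "0 \<le> N x"
    and zero: "N 0 = 0"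
    and minus: "N (- x) = N x"
    and triangle: "N (x + y) \<le> N x + N y"
    and continuous: "continuous_on UNIV N"
begin

lemma continuous_translation: "continuous_on UNIV (\<lambda>x. N (a + x))"
  by (rule continuous_on_compose2[OF continuous]) (auto intro!: continuous_intros)

end

text \<open>Treating a sequence of neighbourhoods at once yields a single seminorm whose zero set
  lies in all of them. With a constant sequence, it gives complete regularity.\<close>

lemma continuous_seminorm_in_nbhds:
  fixes U :: "nat \<Rightarrow> 'a::topological_group_add set"
  assumes U: "\<And>n. open (U n)" "\<And>n. 0 \<in> U n"
  shows "\<exists>N. continuous_seminorm N \<and> (\<forall>n. \<exists>e>0. \<forall>x. N x < e \<longrightarrow> x \<in> U n)"
proof -
  define good where "good W V \<longleftrightarrow> open V \<and> 0 \<in> V \<and> (\<forall>x\<in>V. - x \<in> V) \<and>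
    (\<forall>x\<in>V. \<forall>y\<in>V. \<forall>z\<in>V. x + y + z \<in> W)" for W V :: "'a set"
  have ex: "\<exists>V. good W V" if "open W" "0 \<in> W" for W
    using nbhd_triple[OF that] unfolding good_def by metis
  \<comment> \<open>Starting from \<open>UNIV\<close> gives each \<open>x\<close> the one-term
    representation \<open>[(0, x)]\<close>, so the infimum defining \<open>N x\<close> runs over a
    nonempty set.\<close>
  define V where "V = rec_nat UNIV (\<lambda>n W. SOME V. good (W \<inter> U n) V)"
  have V0: "V 0 = UNIV" and V_Suc: "V (Suc n) = (SOME X. good (V n \<inter> U n) X)" for n
    by (simp_all add: V_def)
  have V: "open (V n) \<and> 0 \<in> V n" for n
  proof (induction n)
    case (Suc n)
    then have "\<exists>X. good (V n \<inter> U n) X"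
      using U by (intro ex) auto
    then have "good (V n \<inter> U n) (V (Suc n))"
      unfolding V_Suc by (rule someI_ex)
    then show ?case
      by (simp add: good_def)
  qed (simp add: V0)
  have good: "good (V n \<inter> U n) (V (Suc n))" for n
    unfolding V_Suc using U V by (intro someI_ex[OF ex]) auto
  have sym: "- x \<in> V n" if "x \<in> V n" for x n
    using that good by (cases n) (auto simp: V0 good_def)
  have triple: "x + y + z \<in> V n" if "x \<in> V (Suc n)" "y \<in> V (Suc n)" "z \<in> V (Suc n)" for x y z n
    using that good[of n] by (auto simp: good_def)
  have VU: "V (Suc n) \<subseteq> U n" for n
  proof
    fix x assume "x \<in> V (Suc n)"
    then have "x + 0 + 0 \<in> V n \<inter> U n"
      using good[of n] V[of "Suc n"] unfolding good_def by blast
    then show "x \<in> U n" by simp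
  qed
  define c where "c ps = (\<Sum>(k, u)\<leftarrow>ps. (1/2::real) ^ k)" for ps :: "(nat \<times> 'a) list"
  define R where "R x = {ps. (\<forall>(k, u)\<in>set ps. u \<in> V k) \<and> sum_list (map snd ps) = x}" for x
  define N where "N x = Inf (c ` R x)" for x
  have c_nonneg: "c ps \<ge> 0" for ps
    unfolding c_def by (rule sum_list_nonneg) auto
  then have bdd: "bdd_below (c ` R x)" for x
    by (auto intro!: bdd_belowI[of _ 0])
  have "[(0, x)] \<in> R x" for x
    by (simp add: R_def V0)
  then have ne: "R x \<noteq> {}" for x
    by blast
  have N_le: "N x \<le> c ps" if "ps \<in> R x" for x ps
    unfolding N_def using that bdd by (intro cInf_lower) auto
  have N_less: "\<exists>ps\<in>R x. c ps < e" if "N x < e" for x e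
    using that ne[of x] bdd by (auto simp: N_def cInf_less_iff)
  have N_nonneg: "0 \<le> N x" for x
    unfolding N_def using ne c_nonneg by (intro cInf_greatest) auto
  have "N 0 \<le> c []"
    by (rule N_le) (simp add: R_def)
  then have N0: "N 0 = 0"
    using N_nonneg[of 0] by (simp add: c_def)
  have N_add: "N (x + y) \<le> N x + N y" for x y
  proof (rule field_le_epsilon)
    fix e :: real assume e: "e > 0"
    obtain ps qs where ps: "ps \<in> R x" "c ps < N x + e/2" and qs: "qs \<in> R y" "c qs < N y + e/2"
      using N_less[of x "N x + e/2"] N_less[of y "N y + e/2"] e by auto
    then have "ps @ qs \<in> R (x + y)"
      by (auto simp: R_def)
    then have "N (x + y) \<le> c (ps @ qs)"
      by (rule N_le)
    then show "N (x + y) \<le> N x + N y + e"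
      using ps qs by (simp add: c_def)
  qed
  have N_minus_le: "N (- x) \<le> N x" for x
  proof (rule field_le_epsilon)
    fix e :: real assume e: "e > 0"
    then obtain ps where ps: "ps \<in> R x" "c ps < N x + e"
      using N_less[of x "N x + e"] by auto
    \<comment> \<open>Negation reverses the order of summands in a noncommutative group, hence
      \<open>rev\<close>; the cost is unaffected.\<close>
    have "sum_list (map snd (rev (map (\<lambda>(k, u). (k, - u)) ps))) = - sum_list (map snd ps)"
      by (induction ps) (auto simp: minus_add)
    with ps have "rev (map (\<lambda>(k, u). (k, - u)) ps) \<in> R (- x)"
      by (auto simp: R_def sym)
    then have "N (- x) \<le> c (rev (map (\<lambda>(k, u). (k, - u)) ps))"
      by (rule N_le)
    also have "\<dots> = c ps"
      by (induction ps) (auto simp: c_def)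
    finally show "N (- x) \<le> N x + e"
      using ps by simp
  qed
  have N_minus: "N (- x) = N x" for x
    using N_minus_le[of x] N_minus_le[of "- x"] by simp
  have N_V: "N x \<le> (1/2) ^ n" if "x \<in> V n" for x n
    using N_le[of "[(n, x)]" x] that by (simp add: R_def c_def)
  have V_N: "x \<in> V n" if less: "N x < (1/2) ^ n" for x n
  proof -
    obtain ps where ps: "ps \<in> R x" "c ps < (1/2) ^ n"
      using N_less[OF less] by auto
    have "sum_list (map snd ps) \<in> V n"
      using ps V triple by (intro chain_in_nbhd) (auto simp: R_def c_def)
    then show ?thesis
      using ps by (simp add: R_def)
  qed
  have N_diff: "\<bar>N y - N x\<bar> \<le> N (- x + y)" for x y
    using N_add[of x "- x + y"] N_add[of y "- y + x"] N_minus[of "- x + y"]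
    by (simp add: minus_add add.assoc[symmetric])
  have "(N \<longlongrightarrow> N x) (at x)" for x
  proof (rule tendstoI)
    fix e :: real assume "e > 0"
    then obtain n where n: "(1/2) ^ n < e"
      using real_arch_pow_inv[of e "1/2"] by auto
    have "\<forall>\<^sub>F y in nhds x. - x + y \<in> V n"
      using open_translation_vimage(1)[of "V n" "- x"] V by (auto simp: eventually_nhds)
    then have "\<forall>\<^sub>F y in nhds x. dist (N y) (N x) < e"
    proof eventually_elim
      case (elim y)
      then show ?case
        using N_diff[of y x] N_V[OF elim] n by (simp add: dist_real_def)
    qed
    then show "\<forall>\<^sub>F y in at x. dist (N y) (N x) < e"
      by (rule filter_leD[OF at_within_le_nhds])
  qed
  then have "continuous_on UNIV N"
    by (simp add: continuous_on_def)
  then have "continuous_seminorm N"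
    using N_nonneg N0 N_minus N_add by unfold_locales
  moreover have "\<exists>e>0. \<forall>x. N x < e \<longrightarrow> x \<in> U n" for n
    using V_N VU[of n] by (intro exI[of _ "(1/2) ^ Suc n"]) auto
  ultimately show ?thesis
    by blast
qed

section \<open>Two-valued measures as ultrafilters\<close>

text \<open>Models the sets of measure \<open>1\<close> under a countably additive two-valued
  measure on all subsets of \<open>S\<close>. Principal ultrafilters, that is, measures with an
  atom, are allowed.\<close>

locale sigma_ultrafilter =
  fixes S :: "'b set" and F :: "'b set \<Rightarrow> bool"
  assumes subset: "F A \<Longrightarrow> A \<subseteq> S"
    and top: "F S"
    and not_empty: "\<not> F {}"
    and mono: "F A \<Longrightarrow> A \<subseteq> B \<Longrightarrow> B \<subseteq> S \<Longrightarrow> F B"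
    and INT: "(\<And>n::nat. F (C n)) \<Longrightarrow> F (\<Inter>n. C n)"
    and ultra: "A \<subseteq> S \<Longrightarrow> F A \<or> F (S - A)"
begin

lemma Int:
  assumes "F A" "F B"
  shows "F (A \<inter> B)"
proof -
  have "F (\<Inter>n::nat. if n = 0 then A else B)"
    using assms by (intro INT) simp
  moreover have "(\<Inter>n::nat. if n = 0 then A else B) = A \<inter> B"
    by (force split: if_splits)
  ultimately show ?thesis by simp
qed

text \<open>The factor \<open>S\<close> covers the empty index set, where the intersection alone
  would be \<open>UNIV\<close>.\<close>

lemma Inter_countable:
  assumes "countable I" "\<And>i. i \<in> I \<Longrightarrow> F (A i)"
  shows "F (S \<inter> (\<Inter>i\<in>I. A i))"
proof (cases "I = {}")
  case False
  then have "F (\<Inter>n. A (from_nat_into I n))"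
    using assms by (intro INT) (simp add: from_nat_into)
  moreover have "(\<Inter>n. A (from_nat_into I n)) = (\<Inter>i\<in>I. A i)"
    using range_from_nat_into[OF False assms(1)] by (metis image_image)
  ultimately show ?thesis
    using subset[of "\<Inter>i\<in>I. A i"] by (simp add: Int_absorb1)
qed (simp add: top)

lemma UN:
  assumes "F (\<Union>n::nat. A n)"
  shows "\<exists>n. F (A n)"
proof (rule ccontr)
  assume *: "\<nexists>n. F (A n)"
  have "F (S - A n)" for n
    using * ultra[of "A n"] subset[OF assms] by blast
  then have "F ((\<Inter>n. S - A n) \<inter> (\<Union>n. A n))"
    by (intro Int INT assms)
  moreover have "(\<Inter>n. S - A n) \<inter> (\<Union>n. A n) = {}"
    by blast
  ultimately show False
    using not_empty by simp
qed

lemma Un: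
  assumes "F (A \<union> B)"
  shows "F A \<or> F B"
proof -
  have "(\<Union>n::nat. if n = 0 then A else B) = A \<union> B"
    by (force split: if_splits)
  then show ?thesis
    using UN[of "\<lambda>n. if n = 0 then A else B"] assms by (auto split: if_splits)
qed

lemma push:
  assumes "h ` S \<subseteq> T"
  shows "sigma_ultrafilter T (\<lambda>B. B \<subseteq> T \<and> F {x \<in> S. h x \<in> B})"
proof
  show "A \<subseteq> T \<and> F {x \<in> S. h x \<in> A} \<Longrightarrow> A \<subseteq> T" for A by blast
  show "T \<subseteq> T \<and> F {x \<in> S. h x \<in> T}"
  proof -
    have "{x \<in> S. h x \<in> T} = S" using assms by blast
    then show ?thesis using top by simp
  qed
  show "\<not> ({} \<subseteq> T \<and> F {x \<in> S. h x \<in> {}})" using not_empty by simp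
  show "B \<subseteq> T \<and> F {x \<in> S. h x \<in> B}"
    if "A \<subseteq> T \<and> F {x \<in> S. h x \<in> A}" "A \<subseteq> B" "B \<subseteq> T" for A B
    using that by (auto intro: mono)
  show "(\<Inter>n. A n) \<subseteq> T \<and> F {x \<in> S. h x \<in> (\<Inter>n. A n)}"
    if "\<And>n::nat. A n \<subseteq> T \<and> F {x \<in> S. h x \<in> A n}" for A
  proof -
    have "F (\<Inter>n. {x \<in> S. h x \<in> A n})"
      using that by (intro INT) auto
    moreover have "(\<Inter>n. {x \<in> S. h x \<in> A n}) = {x \<in> S. h x \<in> (\<Inter>n. A n)}"
      by auto
    moreover have "(\<Inter>n. A n) \<subseteq> T"
      using that by blast
    ultimately show ?thesis
      by simp
  qed
  show "(A \<subseteq> T \<and> F {x \<in> S. h x \<in> A}) \<or> (T - A \<subseteq> T \<and> F {x \<in> S. h x \<in> T - A})"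
    if "A \<subseteq> T" for A
  proof -
    have "S - {x \<in> S. h x \<in> A} = {x \<in> S. h x \<in> T - A}"
      using assms by auto
    then show ?thesis
      using ultra[of "{x \<in> S. h x \<in> A}"] that by auto
  qed
qed

text \<open>For each rational \<open>q\<close>, one side of the cut \<open>f x < q\<close> has full
  measure. The countable intersection of these sides is full, hence nonempty, and \<open>f\<close>
  is constant on it because rationals separate reals.\<close>

lemma real_valued_const:
  fixes f :: "'b \<Rightarrow> real"
  shows "\<exists>r. F {x \<in> S. f x = r}"
proof -
  define A where "A q = (if F {x \<in> S. f x < q} then {x \<in> S. f x < q} else S - {x \<in> S. f x < q})"
    for q
  have "F (A q)" for q
    using ultra[of "{x \<in> S. f x < q}"] by (auto simp: A_def)
  then have F: "F (S \<inter> (\<Inter>q\<in>\<rat>. A q))"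
    by (intro Inter_countable countable_rat)
  then have "S \<inter> (\<Inter>q\<in>\<rat>. A q) \<noteq> {}"
    using not_empty by metis
  then obtain x where x: "x \<in> S" "\<And>q. q \<in> \<rat> \<Longrightarrow> x \<in> A q"
    by blast
  have "\<not> f y < f z" if "y \<in> S" "z \<in> S" "\<And>q. q \<in> \<rat> \<Longrightarrow> y \<in> A q" "\<And>q. q \<in> \<rat> \<Longrightarrow> z \<in> A q" for y z
  proof
    assume "f y < f z"
    then obtain q where "q \<in> \<rat>" "f y < q" "q < f z"
      using Rats_dense_in_real by blast
    with that show False
      by (force simp: A_def split: if_splits)
  qed
  then have "f y = f x" if "y \<in> S" "\<And>q. q \<in> \<rat> \<Longrightarrow> y \<in> A q" for y
    using that x by (metis linorder_neqE)
  then have "S \<inter> (\<Inter>q\<in>\<rat>. A q) \<subseteq> {y \<in> S. f y = f x}"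
    by blast
  with F have "F {y \<in> S. f y = f x}"
    by (rule mono) blast
  then show ?thesis ..
qed

end

section \<open>Translation between measures and ultrafilters\<close>

lemma sigma_ultrafilter_of_measure:
  assumes M: "space M = S" "sets M = Pow S" "\<And>A. A \<subseteq> S \<Longrightarrow> emeasure M A \<in> {0, 1}"
    "emeasure M S = 1"
  shows "sigma_ultrafilter S (\<lambda>A. A \<subseteq> S \<and> emeasure M A = 1)"
proof
  have compl: "emeasure M A + emeasure M (S - A) = 1" if "A \<subseteq> S" for A
    using plus_emeasure[of A M "S - A"] that M by (simp add: Un_absorb1)
  show "(A \<subseteq> S \<and> emeasure M A = 1) \<or> (S - A \<subseteq> S \<and> emeasure M (S - A) = 1)" if "A \<subseteq> S" for A
    using compl[OF that] M(3)[OF that] that by auto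
  show "B \<subseteq> S \<and> emeasure M B = 1" if A: "A \<subseteq> S \<and> emeasure M A = 1" "A \<subseteq> B" "B \<subseteq> S" for A B
  proof -
    have "emeasure M A \<le> emeasure M B"
      using A M(2) by (intro emeasure_mono) auto
    then show ?thesis
      using A M(3)[of B] by auto
  qed
  show "(\<Inter>n. A n) \<subseteq> S \<and> emeasure M (\<Inter>n. A n) = 1"
    if A: "\<And>n::nat. A n \<subseteq> S \<and> emeasure M (A n) = 1" for A
  proof -
    have "emeasure M (S - A n) = 0" for n
      using compl[of "A n"] A[of n] M(3)[of "S - A n"] by auto
    then have "emeasure M (\<Union>n. S - A n) = 0"
      using M(2) by (intro emeasure_UN_eq_0) auto
    moreover have "(\<Union>n. S - A n) = S - (\<Inter>n. A n)" "(\<Inter>n. A n) \<subseteq> S"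
      using A by auto
    ultimately show ?thesis
      using compl[of "\<Inter>n. A n"] by simp
  qed
qed (use M in auto)

text \<open>Countable additivity holds because at most one member of a disjoint family is in
  \<open>F\<close>, and exactly one is when the union is.\<close>

lemma measure_of_sigma_ultrafilter:
  assumes "sigma_ultrafilter S F"
  shows "\<exists>M. space M = S \<and> sets M = Pow S \<and> (\<forall>A\<subseteq>S. emeasure M A = (if F A then 1 else 0))"
proof -
  interpret sigma_ultrafilter S F by fact
  define \<mu> :: "'a set \<Rightarrow> ennreal" where "\<mu> A = (if F A then 1 else 0)" for A
  have "countably_additive (Pow S) \<mu>"
    unfolding countably_additive_def
  proof (intro allI impI)
    fix A :: "nat \<Rightarrow> 'a set"
    assume A: "range A \<subseteq> Pow S" and disj: "disjoint_family A"
    show "(\<Sum>i. \<mu> (A i)) = \<mu> (\<Union>i. A i)"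
    proof (cases "\<exists>n. F (A n)")
      case True
      then obtain n where n: "F (A n)" ..
      then have "F (\<Union>i. A i)"
        using A by (intro mono[OF n]) auto
      have "\<not> F (A i)" if "i \<noteq> n" for i
        using Int[OF n, of "A i"] that disj not_empty by (auto simp: disjoint_family_on_def)
      then have "(\<Sum>i. \<mu> (A i)) = (\<Sum>i\<in>{n}. \<mu> (A i))"
        by (intro suminf_finite) (auto simp: \<mu>_def)
      with n \<open>F (\<Union>i. A i)\<close> show ?thesis
        by (simp add: \<mu>_def)
    next
      case False
      then have "\<not> F (\<Union>i. A i)"
        using UN by blast
      with False show ?thesis
        by (simp add: \<mu>_def)
    qed
  qed
  then have *: "emeasure (measure_of S (Pow S) \<mu>) A = \<mu> A" if "A \<subseteq> S" for A
    using that not_empty by (intro emeasure_measure_of_sigma)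
      (auto simp: \<mu>_def positive_def sigma_algebra_Pow)
  show ?thesis
    by (rule exI[of _ "measure_of S (Pow S) \<mu>"])
      (auto simp: * \<mu>_def sigma_algebra.sets_measure_of_eq[OF sigma_algebra_Pow] space_measure_of_conv)
qed

lemma ulam_measurable_card_of:
  "ulam_measurable |S| \<longleftrightarrow> (\<exists>F. sigma_ultrafilter S F \<and> (\<forall>x\<in>S. \<not> F {x}))"
proof
  assume "ulam_measurable |S|"
  then obtain M where "space M = S \<and> sets M = Pow S \<and> (\<forall>A\<subseteq>S. emeasure M A \<in> {0, 1}) \<and>
      (\<forall>x\<in>S. emeasure M {x} = 0) \<and> emeasure M S = 1"
    unfolding ulam_measurable_def Field_card_of ..
  moreover then have "sigma_ultrafilter S (\<lambda>A. A \<subseteq> S \<and> emeasure M A = 1)"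
    by (intro sigma_ultrafilter_of_measure) auto
  ultimately show "\<exists>F. sigma_ultrafilter S F \<and> (\<forall>x\<in>S. \<not> F {x})"
    by (intro exI[of _ "\<lambda>A. A \<subseteq> S \<and> emeasure M A = 1"]) simp
next
  assume "\<exists>F. sigma_ultrafilter S F \<and> (\<forall>x\<in>S. \<not> F {x})"
  then obtain F where F: "sigma_ultrafilter S F" "\<And>x. x \<in> S \<Longrightarrow> \<not> F {x}"
    by blast
  obtain M where "space M = S \<and> sets M = Pow S \<and>
      (\<forall>A\<subseteq>S. emeasure M A = (if F A then 1 else 0))"
    using measure_of_sigma_ultrafilter[OF F(1)] ..
  with F show "ulam_measurable |S|"
    unfolding ulam_measurable_def Field_card_of
    by (intro exI[of _ M]) (auto simp: sigma_ultrafilter.top)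
qed

text \<open>The image measure on \<open>T\<close> must have an atom. Used in the form: if a
  partition has a non-measurable number of pieces, one piece has full measure.\<close>

lemma (in sigma_ultrafilter) ex_fibre:
  assumes "h ` S \<subseteq> T" "\<not> ulam_measurable |T|"
  shows "\<exists>c\<in>T. F {x \<in> S. h x = c}"
proof -
  have "\<not> (\<forall>c\<in>T. \<not> ({c} \<subseteq> T \<and> F {x \<in> S. h x \<in> {c}}))"
    using push[OF assms(1)] assms(2) unfolding ulam_measurable_card_of by blast
  then show ?thesis
    by simp
qed

text \<open>Removes the summand \<open>nat\<close> that the type of
  \<open>precompactness_index\<close> brings in: the countable part is null, so an atom of the image
  on \<open>'a\<close> would already be an atom upstairs.\<close>

lemma ulam_measurable_Plus_nat:
  assumes "ulam_measurable |UNIV :: ('a + nat) set|"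
  shows "ulam_measurable |UNIV :: 'a set|"
proof -
  obtain F :: "('a + nat) set \<Rightarrow> bool" where F: "sigma_ultrafilter UNIV F" "\<And>x. \<not> F {x}"
    using assms unfolding ulam_measurable_card_of by blast
  interpret sigma_ultrafilter UNIV F by fact
  have "\<not> F (\<Union>n. {Inr n})"
    using UN[of "\<lambda>n. {Inr n}"] F(2) by blast
  moreover have "UNIV = range Inl \<union> (\<Union>n::nat. {Inr n :: 'a + nat})"
    by (auto intro: sum.exhaust_sel)
  ultimately have "F (range Inl)"
    using top Un by metis
  show ?thesis
  proof (rule ccontr)
    assume "\<not> ?thesis"
    \<comment> \<open>The value on \<open>Inr\<close> is immaterial, since \<open>range Inl\<close>
      has full measure.\<close>
    define h :: "'a + nat \<Rightarrow> 'a" where "h = case_sum id (\<lambda>n. undefined)"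
    have h: "h (Inl a) = a" for a
      by (simp add: h_def)
    obtain c where "F {x \<in> UNIV. h x = c}"
      using ex_fibre[of h UNIV] \<open>\<not> ulam_measurable |UNIV :: 'a set|\<close> by blast
    from Int[OF this \<open>F (range Inl)\<close>] have "F {Inl c}"
      by (rule mono) (auto simp: h)
    with F(2) show False by blast
  qed
qed

section \<open>Metrizability and cardinality\<close>

text \<open>Only separation of points is added; the metric topology may be strictly coarser than
  that of the group.\<close>

locale continuous_norm = continuous_seminorm +
  assumes eq_0: "N x = 0 \<Longrightarrow> x = 0"
begin

lemma eq_0_iff: "N (- x + y) = 0 \<longleftrightarrow> x = y"
  using eq_0[of "- x + y"] zero neg_eq_iff_add_eq_0[of "- x" y] by auto

lemma Metric_space: "Metric_space UNIV (\<lambda>x y. N (- x + y))"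
proof
  show "N (- x + y) = N (- y + x)" for x y
    using minus[of "- x + y"] by (simp add: minus_add)
  show "N (- x + z) \<le> N (- x + y) + N (- y + z)" for x y z
    using triangle[of "- x + y" "- y + z"] by (simp add: add.assoc)
qed (simp_all add: nonneg eq_0_iff)

end

text \<open>Write \<open>{0}\<close> as an intersection of open sets \<open>C n\<close> and build
  the seminorm for this sequence: its zeros lie in every \<open>C n\<close>.\<close>

lemma ex_continuous_norm:
  assumes "countable_pseudocharacter (euclidean :: 'a::topological_group_add topology)"
  shows "\<exists>N :: 'a::topological_group_add \<Rightarrow> real. continuous_norm N"
proof -
  have "gdelta_in euclidean {0 :: 'a}"
    using assms by (simp add: countable_pseudocharacter_def)
  then obtain C where opn: "\<And>n::nat. open (C n)" and C: "\<Inter>(range C) = {0::'a}"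
    unfolding gdelta_in_descending by auto
  from C have zero: "0 \<in> C n" for n
    by blast
  obtain N :: "'a \<Rightarrow> real" where N: "continuous_seminorm N"
    "\<And>n. \<exists>e>0. \<forall>x. N x < e \<longrightarrow> x \<in> C n"
    using continuous_seminorm_in_nbhds[of C, OF opn zero] by blast
  have "x = 0" if "N x = 0" for x
  proof -
    have "x \<in> \<Inter>(range C)"
      using N(2) that by force
    then show ?thesis
      by (simp add: C)
  qed
  then have "continuous_norm N"
    using N(1) by (simp add: continuous_norm_def continuous_norm_axioms_def)
  then show ?thesis
    by blast
qed

text \<open>Balls are open in the group because \<open>N\<close> is continuous. Left translations
  are isometries, and the one by \<open>y - x\<close> moves \<open>x\<close> to
  \<open>y\<close>.\<close>

lemma countable_pseudocharacter_imp_coarser_metrizable: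
  assumes "countable_pseudocharacter (euclidean :: 'a::topological_group_add topology)"
  shows "\<exists>T. coarser_topology T (euclidean :: 'a::topological_group_add topology) \<and>
    homogeneous_space T \<and> metrizable_space T"
proof -
  obtain N :: "'a \<Rightarrow> real" where "continuous_norm N"
    using ex_continuous_norm[OF assms] ..
  then interpret continuous_norm N .
  define d where "d x y = N (- x + y)" for x y
  have d_translation: "d (a + x) (a + y) = d x y" for a x y
    unfolding d_def by (simp only: minus_add add.assoc minus_add_cancel)
  interpret Metric_space UNIV d
    unfolding d_def by (rule Metric_space)
  have "open U" if U: "openin mtopology U" for U :: "'a set"
    unfolding open_subopen[of U]
  proof
    fix x assume "x \<in> U"
    then obtain r where r: "r > 0" "mball x r \<subseteq> U"
      using U unfolding openin_mtopology by blast
    have "open (mball x r)"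
      using continuous_translation[of "- x"] by (auto simp: mball_def d_def intro!: open_Collect_less continuous_intros)
    with r show "\<exists>T. open T \<and> x \<in> T \<and> T \<subseteq> U"
      by (intro exI[of _ "mball x r"]) auto
  qed
  then have "coarser_topology mtopology euclidean"
    by (simp add: coarser_topology_def)
  moreover have "homogeneous_space mtopology"
    unfolding homogeneous_space_def
  proof (intro ballI)
    fix x y :: 'a
    have "continuous_map mtopology mtopology ((+) a)" for a
      unfolding continuous_map_to_metric by (auto simp: in_mball d_translation intro!: exI[of _ "mball _ _"])
    then have "homeomorphic_maps mtopology mtopology ((+) (y - x)) ((+) (- (y - x)))"
      by (simp add: homeomorphic_maps_def add.assoc[symmetric] del: minus_diff_eq)
    then show "\<exists>f. homeomorphic_map mtopology mtopology f \<and> f x = y"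
      by (intro exI[of _ "(+) (y - x)"] conjI homeomorphic_maps_imp_map) simp_all
  qed
  ultimately show ?thesis
    using metrizable_space_mtopology by blast
qed

text \<open>Singletons are closed, hence G_delta, in a metrizable topology, and the same open sets
  serve in the finer one.\<close>

lemma coarser_metrizable_imp_countable_pseudocharacter:
  assumes "coarser_topology T X" "metrizable_space T"
  shows "countable_pseudocharacter X"
  unfolding countable_pseudocharacter_def
proof
  fix x assume "x \<in> topspace X"
  then have "x \<in> topspace T"
    using assms(1) by (simp add: coarser_topology_def)
  then have "closedin T {x}"
    using metrizable_imp_Hausdorff_space[OF assms(2)] by (rule closedin_Hausdorff_singleton[rotated])
  then have "gdelta_in T {x}"
    using assms(2) by (intro closed_imp_gdelta_in)
  then show "gdelta_in X {x}"
    using assms(1) unfolding gdelta_in_descending coarser_topology_def by metis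
qed

text \<open>The cardinal of \<open>'a + nat\<close> is infinite and trivially bounds the index;
  measurability passes up to it and then down to \<open>'a\<close>.\<close>

lemma not_ulam_measurable_precompactness_index:
  assumes "\<not> ulam_measurable |UNIV :: 'a::topological_group_add set|"
  shows "\<not> ulam_measurable (precompactness_index (UNIV :: 'a::topological_group_add set))"
proof
  assume *: "ulam_measurable (precompactness_index (UNIV :: 'a set))"
  have "Cinfinite |UNIV :: ('a + nat) set|"
    unfolding cinfinite_def Field_card_of
    by (simp add: finite_Plus_UNIV_iff card_of_card_order_on)
  moreover have "|UNIV :: 'a set| \<le>o |UNIV :: ('a + nat) set|"
    by (rule card_of_ordLeqI[of Inl]) auto
  ultimately have "precompactness_index (UNIV :: 'a set) \<le>o |UNIV :: ('a + nat) set|"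
    by (intro precompactness_index card_precompact_card_of)
  then have "ulam_measurable |UNIV :: ('a + nat) set|"
    using precompactness_index(1)[of "UNIV :: 'a set"]
    by (intro ulam_measurable_mono[OF * _ card_of_Card_order]) auto
  with assms show False
    using ulam_measurable_Plus_nat by blast
qed

text \<open>
  If \<open>G\<close> is covered by the translates \<open>s + U\<^sub>n\<close>, \<open>s \<in> S\<^sub>n\<close>, then a two-valued measure on \<open>G\<close>
  concentrates on a single translate for each \<open>n\<close>, and the intersection of these has at most one point.
\<close>

lemma not_ulam_measurable_UNIV:
  assumes cps: "countable_pseudocharacter (euclidean :: 'a::topological_group_add topology)"
    and ip: "\<not> ulam_measurable (precompactness_index (UNIV :: 'a::topological_group_add set))"
  shows "\<not> ulam_measurable |UNIV :: 'a::topological_group_add set|"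
proof
  assume "ulam_measurable |UNIV :: 'a set|"
  then obtain F :: "'a set \<Rightarrow> bool" where F: "sigma_ultrafilter UNIV F" "\<And>x. \<not> F {x}"
    unfolding ulam_measurable_card_of by blast
  interpret sigma_ultrafilter UNIV F by fact
  obtain N :: "'a \<Rightarrow> real" where "continuous_norm N"
    using ex_continuous_norm[OF cps] ..
  then interpret continuous_norm N .
  have "\<exists>c. F {x. N (- c + x) < inverse (Suc n)}" for n
  proof -
    let ?U = "{x. N x < inverse (Suc n)}"
    have "open ?U" "0 \<in> ?U"
      using continuous zero by (auto intro!: open_Collect_less continuous_intros)
    then have "\<exists>S\<subseteq>UNIV. |S| \<le>o precompactness_index (UNIV :: 'a set) \<and>
        UNIV \<subseteq> (S + ?U) \<inter> (?U + S)"
      using precompactness_index(2)[of "UNIV :: 'a set"] unfolding card_precompact_def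
      by (elim allE[of _ ?U] impE conjI)
    then obtain S where S: "|S| \<le>o precompactness_index (UNIV :: 'a set)" "UNIV \<subseteq> S + ?U"
      by (elim exE conjE) simp
    have "\<not> ulam_measurable |S|"
      using ip ulam_measurable_mono[OF _ card_of_Card_order _ S(1)]
        precompactness_index(1)[of "UNIV :: 'a set"] by blast
    moreover have "\<exists>s\<in>S. N (- s + x) < inverse (Suc n)" for x
    proof -
      obtain s u where "s \<in> S" "u \<in> ?U" "x = s + u"
        using S(2) by (blast elim: set_plus_elim)
      then show ?thesis
        by (intro bexI[of _ s]) simp_all
    qed
    \<comment> \<open>Choosing a centre for every point partitions the group into fibres indexed by
      \<open>S\<close>; the fibre of full measure lies in a ball around its centre
      \<open>c\<close>.\<close>
    then obtain s where s: "\<And>x. s x \<in> S" "\<And>x. N (- s x + x) < inverse (Suc n)"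
      by metis
    ultimately obtain c where "F {x \<in> UNIV. s x = c}"
      using ex_fibre[of s S] by blast
    then have "F {x. N (- c + x) < inverse (Suc n)}"
      by (rule mono) (use s in auto)
    then show ?thesis ..
  qed
  then obtain c where c: "\<And>n. F {x. N (- c n + x) < inverse (Suc n)}"
    by metis
  then have FI: "F (\<Inter>n. {x. N (- c n + x) < inverse (Suc n)})"
    by (rule INT)
  then obtain x where x: "\<And>n. N (- c n + x) < inverse (Suc n)"
    using not_empty by (smt (verit) INT_iff equals0I mem_Collect_eq UNIV_I)
  have "y = x" if y: "\<And>n. N (- c n + y) < inverse (Suc n)" for y
  proof (rule ccontr)
    assume "y \<noteq> x"
    then have "N (- x + y) > 0"
      using nonneg[of "- x + y"] eq_0_iff[of x y] by (auto simp: less_le)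
    then obtain n where "inverse (Suc n) < N (- x + y) / 2"
      using reals_Archimedean[of "N (- x + y) / 2"] by auto
    moreover have "N (- x + y) \<le> N (- c n + x) + N (- c n + y)"
      using triangle[of "- (- c n + x)" "- c n + y"] minus[of "- c n + x"]
      by (metis add.assoc add_minus_cancel minus_add minus_minus)
    ultimately show False
      using x[of n] y[of n] by simp
  qed
  then have "F {x}"
    by (intro mono[OF FI]) auto
  with F(2) show False by blast
qed

text \<open>Each coordinate of the closed embedding is constant on a full set, and these constants
  form a point \<open>p\<close>. Boxes restrict finitely many coordinates, so neighbourhoods of
  \<open>p\<close> have full preimage, and closedness puts \<open>p\<close> in the image. Its
  preimage point is the intersection of countably many full open sets, hence an atom.\<close>

lemma realcompact_imp_not_ulam_measurable:
  assumes "realcompact_space X" "countable_pseudocharacter X"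
  shows "\<not> ulam_measurable |topspace X|"
proof
  assume "ulam_measurable |topspace X|"
  then obtain F where F: "sigma_ultrafilter (topspace X) F" "\<And>x. x \<in> topspace X \<Longrightarrow> \<not> F {x}"
    unfolding ulam_measurable_card_of by blast
  interpret sigma_ultrafilter "topspace X" F by fact
  obtain I :: "('a \<Rightarrow> real) set" and C e d where C: "closedin (powertop_real I) C"
    and ed: "homeomorphic_maps X (subtopology (powertop_real I) C) e d"
    using assms(1) unfolding realcompact_space_def homeomorphic_space_def by blast
  obtain r where r: "\<And>i. F {x \<in> topspace X. e x i = r i}"
    using real_valued_const[of "\<lambda>x. e x i" for i] by metis
  define p where "p = restrict r I"
  have e_C: "e x \<in> C" "e x \<in> topspace (powertop_real I)" if "x \<in> topspace X" for x
    using ed that unfolding homeomorphic_maps_def continuous_map_def by auto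
  have nbhd: "F {x \<in> topspace X. e x \<in> W}" if W: "openin (powertop_real I) W" "p \<in> W" for W
  proof -
    obtain U where U: "finite {i \<in> I. U i \<noteq> topspace euclideanreal}" "p \<in> Pi\<^sub>E I U" "Pi\<^sub>E I U \<subseteq> W"
      using bspec[OF W(1)[unfolded openin_product_topology_alt] W(2)] by (elim exE conjE)
    let ?J = "{i \<in> I. U i \<noteq> topspace euclideanreal}"
    have "F (topspace X \<inter> (\<Inter>i\<in>?J. {x \<in> topspace X. e x i = r i}))"
      using U(1) r by (intro Inter_countable) (auto intro: countable_finite)
    then show ?thesis
    proof (rule mono)
      show "topspace X \<inter> (\<Inter>i\<in>?J. {x \<in> topspace X. e x i = r i}) \<subseteq> {x \<in> topspace X. e x \<in> W}"
      proof safe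
        fix x assume x: "x \<in> topspace X" "x \<in> (\<Inter>i\<in>?J. {x \<in> topspace X. e x i = r i})"
        have "e x i \<in> U i" if "i \<in> I" for i
          using x U(2) that by (cases "i \<in> ?J") (auto simp: p_def PiE_def Pi_def)
        then have "e x \<in> Pi\<^sub>E I U"
          using e_C(2)[OF x(1)] by auto
        then show "e x \<in> W" using U(3) by blast
      qed
    qed auto
  qed
  have p_top: "p \<in> topspace (powertop_real I)"
    by (simp add: p_def)
  have "p \<in> C"
  proof (rule ccontr)
    assume "p \<notin> C"
    then have "F {x \<in> topspace X. e x \<in> topspace (powertop_real I) - C}"
      using C p_top by (intro nbhd openin_diff openin_topspace) auto
    moreover have "{x \<in> topspace X. e x \<in> topspace (powertop_real I) - C} = {}"
      using e_C by blast
    ultimately show False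
      using not_empty by metis
  qed
  then have "p \<in> topspace (subtopology (powertop_real I) C)"
    using p_top by simp
  then have dp: "d p \<in> topspace X" "e (d p) = p"
    using ed unfolding homeomorphic_maps_def continuous_map_def by blast+
  have F_open: "F V" if V: "openin X V" "d p \<in> V" for V
  proof -
    have "openin (subtopology (powertop_real I) C) (e ` V)"
      using ed V(1) homeomorphic_maps_imp_map homeomorphic_map_openness_eq by blast
    then obtain W where W: "openin (powertop_real I) W" "e ` V = W \<inter> C"
      unfolding openin_subtopology by blast
    then have "F {x \<in> topspace X. e x \<in> W}"
      using V dp by (intro nbhd) force+
    moreover have "{x \<in> topspace X. e x \<in> W} \<subseteq> V"
    proof safe
      fix x assume x: "x \<in> topspace X" "e x \<in> W"
      then obtain v where "v \<in> V" "e v = e x"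
        using W(2) e_C by force
      moreover have "d (e v) = v" "d (e x) = x"
        using ed x V(1) \<open>v \<in> V\<close> openin_subset unfolding homeomorphic_maps_def by blast+
      ultimately show "x \<in> V" by metis
    qed
    ultimately show ?thesis
      using mono openin_subset[OF V(1)] by blast
  qed
  obtain A where A: "\<And>n::nat. openin X (A n)" "\<Inter>(range A) = {d p}"
    using assms(2) dp(1) unfolding countable_pseudocharacter_def gdelta_in_descending by metis
  have "F (\<Inter>n. A n)"
    using A by (intro INT F_open) auto
  then show False
    using A F(2) dp(1) by simp
qed

section \<open>Realcompactness of subspaces\<close>

text \<open>
  If \<open>h\<close> is the sum of the functions \<open>min (2 ^ - n) \<bar>f n - p (f n)\<bar>\<close> and \<open>h\<close> has no zero, then the
  finitely many conditions on \<open>1 / h\<close> and \<open>f 0, \<dots>, f m\<close> contradict each other for large \<open>m\<close>.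
\<close>

lemma limit_of_evaluations_countable:
  fixes Y :: "'a::topological_space set" and p :: "('a \<Rightarrow> real) \<Rightarrow> real"
  assumes lim: "\<And>J e. finite J \<Longrightarrow> (\<And>g. g \<in> J \<Longrightarrow> continuous_on Y g) \<Longrightarrow> e > 0 \<Longrightarrow>
      \<exists>y\<in>Y. \<forall>g\<in>J. \<bar>g y - p g\<bar> < e"
    and f: "\<And>n::nat. continuous_on Y (f n)"
  shows "\<exists>y\<in>Y. \<forall>n. f n y = p (f n)"
proof (rule ccontr)
  assume no_zero: "\<not> ?thesis"
  \<comment> \<open>The cap \<open>(1/2) ^ n\<close> makes the series converge uniformly, so that
    \<open>h\<close> is continuous on \<open>Y\<close>.\<close>
  define g where "g n y = min ((1/2) ^ n) \<bar>f n y - p (f n)\<bar>" for n y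
  define h where "h y = (\<Sum>n. g n y)" for y
  have g: "0 \<le> g n y" "g n y \<le> (1/2) ^ n" "g n y \<le> \<bar>f n y - p (f n)\<bar>" for n y
    by (auto simp: g_def)
  have geometric: "summable (\<lambda>n. (1/2::real) ^ n)"
    by (simp add: summable_geometric)
  have summable: "summable (\<lambda>n. g n y)" for y
    by (rule summable_comparison_test[OF _ geometric]) (auto intro!: exI[of _ 0] simp: g)
  have unif: "uniform_limit Y (\<lambda>n y. \<Sum>i<n. g i y) h sequentially"
    unfolding h_def by (rule Weierstrass_m_test[OF _ geometric]) (simp add: g)
  have "continuous_on Y (\<lambda>y. \<Sum>i<n. g i y)" for n
    unfolding g_def by (intro continuous_intros f)
  then have "continuous_on Y h"
    by (intro uniform_limit_theorem[OF _ unif]) auto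
  moreover have h_pos: "h y > 0" if y: "y \<in> Y" for y
  proof -
    obtain n where "f n y \<noteq> p (f n)"
      using no_zero y by blast
    then have "0 < g n y"
      by (simp add: g_def)
    then show ?thesis
      unfolding h_def using summable g(1) by (intro suminf_pos2)
  qed
  ultimately have q_cont: "continuous_on Y (\<lambda>y. 1 / h y)"
    by (intro continuous_intros) (auto simp: less_imp_neq[THEN not_sym])
  define q where "q = (\<lambda>y. 1 / h y)"
  define K where "K = \<bar>p q\<bar> + 1"
  have K: "K > 0"
    by (simp add: K_def)
  then have "\<forall>\<^sub>F n in sequentially. \<forall>y\<in>Y. dist (\<Sum>i<n. g i y) (h y) < 1 / (2 * K)"
    by (intro uniform_limitD[OF unif]) simp
  then obtain m where m: "\<And>y. y \<in> Y \<Longrightarrow> dist (\<Sum>i<m. g i y) (h y) < 1 / (2 * K)"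
    by (auto simp: eventually_sequentially)
  \<comment> \<open>The first \<open>m\<close> terms then add up to at most
    \<open>1 / (2 * K)\<close> and the tail to less than that again, so \<open>q y > K\<close>; but
    \<open>e \<le> 1\<close> keeps \<open>q y\<close> below \<open>K\<close>.\<close>
  define e where "e = min 1 (1 / (2 * K * (real m + 1)))"
  have "e > 0"
    using K by (simp add: e_def)
  obtain y where y: "y \<in> Y" "\<forall>g\<in>insert q (f ` {..<m}). \<bar>g y - p g\<bar> < e"
    using lim[of "insert q (f ` {..<m})" e] f q_cont \<open>e > 0\<close> by (auto simp: q_def)
  have "(\<Sum>i<m. g i y) \<le> (\<Sum>i<m. e)"
    using y(2) g(3)[of _ y] by (intro sum_mono) (meson imageI insertCI lessThan_iff less_imp_le order_trans)
  also have "\<dots> = m * e"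
    by simp
  also have "\<dots> \<le> m * (1 / (2 * K * (real m + 1)))"
    by (rule mult_left_mono) (auto simp: e_def)
  also have "\<dots> \<le> 1 / (2 * K)"
    using K by (simp add: divide_simps)
  finally have "h y < 1 / (2 * K) + 1 / (2 * K)"
    using m[OF y(1)] by (simp add: dist_real_def abs_less_iff)
  then have "h y < 1 / K"
    by simp
  then have "K < q y"
    using K h_pos[OF y(1)] by (simp add: q_def field_simps)
  moreover have "q y < p q + 1"
    using y(2) by (simp add: e_def abs_less_iff)
  ultimately show False
    by (simp add: K_def)
qed

section \<open>Distance functions and Stone covers for the metric of a norm\<close>

context continuous_norm
begin

definition d :: "'a \<Rightarrow> 'a \<Rightarrow> real" where "d x y = N (- x + y)"

sublocale metric: Metric_space UNIV d
  unfolding d_def by (rule Metric_space)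

text \<open>Truncating at \<open>1\<close> makes the infimum meaningful for empty \<open>D\<close>,
  which gets distance \<open>1\<close> from every point. This is why nearby points of
  \<open>D\<close> are extracted below only for radii up to \<open>1\<close>.\<close>

definition dist_to :: "'a set \<Rightarrow> 'a \<Rightarrow> real" where
  "dist_to D z = Inf (insert 1 (d z ` D))"

lemma bdd_below_dist: "bdd_below (insert 1 (d z ` D))"
  by (rule bdd_belowI[of _ 0]) auto

lemma dist_to_nonneg: "0 \<le> dist_to D z"
  unfolding dist_to_def by (rule cInf_greatest) auto

lemma dist_to_le: "a \<in> D \<Longrightarrow> dist_to D z \<le> d z a"
  unfolding dist_to_def by (rule cInf_lower[OF _ bdd_below_dist]) blast

lemma dist_to_lessD:
  assumes "dist_to D z < e" "e \<le> 1"
  shows "\<exists>a\<in>D. d z a < e"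
  using assms cInf_less_iff[OF _ bdd_below_dist[of z D], of e] unfolding dist_to_def by auto

lemma dist_to_Lipschitz: "dist_to D z \<le> dist_to D w + d z w"
proof -
  have "dist_to D z - d z w \<le> dist_to D w"
    unfolding dist_to_def[of D w]
  proof (rule cInf_greatest)
    fix x assume "x \<in> insert 1 (d w ` D)"
    moreover have "dist_to D z \<le> 1"
      unfolding dist_to_def by (rule cInf_lower[OF _ bdd_below_dist]) blast
    moreover have "dist_to D z - d z w \<le> d w a" if "a \<in> D" for a
      using dist_to_le[OF that, of z] metric.triangle[of z w a] by auto
    ultimately show "dist_to D z - d z w \<le> x"
      by (auto intro: order_trans[of _ "dist_to D z"])
  qed auto
  then show ?thesis by simp
qed

lemma continuous_d: "continuous_on UNIV (d c)"
  unfolding d_def by (rule continuous_translation)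

lemma continuous_dist_to: "continuous_on UNIV (dist_to D)"
proof -
  have "(dist_to D \<longlongrightarrow> dist_to D z) (at z)" for z
  proof (rule tendstoI)
    fix e :: real assume "e > 0"
    have "open {w. d z w < e}"
      using continuous_d by (intro open_Collect_less) auto
    then have "\<forall>\<^sub>F w in nhds z. d z w < e"
      using \<open>e > 0\<close> by (auto simp: eventually_nhds)
    then have "\<forall>\<^sub>F w in nhds z. dist (dist_to D w) (dist_to D z) < e"
    proof eventually_elim
      case (elim w)
      then show ?case
        using dist_to_Lipschitz[of D z w] dist_to_Lipschitz[of D w z] metric.commute[of z w]
        by (simp add: dist_real_def abs_less_iff)
    qed
    then show "\<forall>\<^sub>F w in at z. dist (dist_to D w) (dist_to D z) < e"
      by (rule filter_leD[OF at_within_le_nhds])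
  qed
  then show ?thesis
    by (simp add: continuous_on_def)
qed

text \<open>
  Stone's argument: \<open>\<pi> z\<close> is the first point within \<open>\<epsilon>\<close> of \<open>z\<close> in a well-ordering.
\<close>

lemma sigma_discrete_cover:
  assumes "\<epsilon> > 0"
  shows "\<exists>\<pi> A. (\<forall>z. \<exists>n::nat. z \<in> A n) \<and> (\<forall>n. \<forall>z\<in>A n. d z (\<pi> z) \<le> \<epsilon> - inverse (Suc n)) \<and>
    (\<forall>n. \<forall>z\<in>A n. \<forall>w\<in>A n. d z w < inverse (Suc n) \<longrightarrow> \<pi> z = \<pi> w)"
proof -
  obtain r :: "'a rel" where r: "Well_order r" "Field r = UNIV"
    using well_ordering[where 'a = 'a] by (elim exE conjE)
  then have wf: "wf (r - Id)" and total: "\<And>x y. x \<noteq> y \<Longrightarrow> (x, y) \<in> r \<or> (y, x) \<in> r"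
    by (auto simp: well_order_on_def linear_order_on_def total_on_def)
  have "\<exists>y. d z y < \<epsilon> \<and> (\<forall>x. (x, y) \<in> r - Id \<longrightarrow> \<not> d z x < \<epsilon>)" for z
    using wfE_min[OF wf, of z "{y. d z y < \<epsilon>}"] \<open>\<epsilon> > 0\<close> by auto
  then obtain \<pi> where \<pi>: "\<And>z. d z (\<pi> z) < \<epsilon>" "\<And>z x. (x, \<pi> z) \<in> r - Id \<Longrightarrow> \<not> d z x < \<epsilon>"
    by metis
  \<comment> \<open>The slack \<open>inverse (Suc n)\<close> guarantees that any \<open>w\<close>
    closer than this to \<open>z\<close> is still within \<open>\<epsilon>\<close> of
    \<open>\<pi> z\<close>, so \<open>\<pi> z\<close> cannot strictly precede
    \<open>\<pi> w\<close>.\<close>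
  define A where "A n = {z. d z (\<pi> z) \<le> \<epsilon> - inverse (Suc n)}" for n :: nat
  have "(\<pi> z, \<pi> w) \<notin> r - Id" if "z \<in> A n" "d z w < inverse (Suc n)" for n z w
  proof
    assume "(\<pi> z, \<pi> w) \<in> r - Id"
    moreover have "d w (\<pi> z) \<le> d z w + d z (\<pi> z)"
      using metric.triangle[of w z "\<pi> z"] metric.commute[of w z] by simp
    ultimately show False
      using \<pi>(2)[of "\<pi> z" w] that by (simp add: A_def)
  qed
  then have "\<pi> z = \<pi> w" if "z \<in> A n" "w \<in> A n" "d z w < inverse (Suc n)" for n z w
    using that total[of "\<pi> z" "\<pi> w"] metric.commute[of z w] by (metis DiffI pair_in_Id_conv)
  moreover have "\<exists>n. z \<in> A n" for z
  proof -
    obtain n where "inverse (Suc n) < \<epsilon> - d z (\<pi> z)"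
      using reals_Archimedean[of "\<epsilon> - d z (\<pi> z)"] \<pi>(1)[of z] by auto
    then show ?thesis
      by (intro exI[of _ n]) (simp add: A_def)
  qed
  ultimately show ?thesis
    by (intro exI[of _ \<pi>] exI[of _ A]) (auto simp: A_def)
qed

lemma small_ball:
  fixes Y :: "'a set" and p :: "('a \<Rightarrow> real) \<Rightarrow> real"
  assumes cip: "\<And>f. (\<And>n::nat. continuous_on Y (f n)) \<Longrightarrow> \<exists>y\<in>Y. \<forall>n. f n y = p (f n)"
    and not_ulam: "\<not> ulam_measurable |UNIV :: 'a set|"
    and \<epsilon>: "\<epsilon> > 0"
  shows "\<exists>c. p (\<lambda>z. max 0 (d c z - \<epsilon>)) = 0"
proof -
  obtain \<pi> A where cover: "\<And>z. \<exists>n::nat. z \<in> A n"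
    and A: "\<And>n z. z \<in> A n \<Longrightarrow> d z (\<pi> z) \<le> \<epsilon> - inverse (Suc n)"
    and sep: "\<And>n z w. z \<in> A n \<Longrightarrow> w \<in> A n \<Longrightarrow> d z w < inverse (Suc n) \<Longrightarrow> \<pi> z = \<pi> w"
    using sigma_discrete_cover[OF \<epsilon>] by blast
  define \<phi> where "\<phi> m B = dist_to (A m \<inter> \<pi> -` B)" for m B
  have cont: "continuous_on Y (\<phi> m B)" for m B
    unfolding \<phi>_def by (rule continuous_on_subset[OF continuous_dist_to]) simp
  have "\<exists>m. p (\<phi> m UNIV) = 0"
  proof -
    obtain y where y: "\<And>m. \<phi> m UNIV y = p (\<phi> m UNIV)"
      using cip[of "\<lambda>m. \<phi> m UNIV"] cont by blast
    obtain m where "y \<in> A m"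
      using cover by blast
    then have "\<phi> m UNIV y = 0"
      using dist_to_le[of y "A m" y] dist_to_nonneg[of "A m" y] by (simp add: \<phi>_def)
    then show ?thesis
      using y by metis
  qed
  then obtain m where m: "p (\<phi> m UNIV) = 0" ..
  define \<delta> where "\<delta> = inverse (real (Suc m))"
  have \<delta>: "\<delta> > 0" "\<delta> \<le> 1"
    by (auto simp: \<delta>_def inverse_le_1_iff)
  \<comment> \<open>Members of \<open>A m\<close> within \<open>\<delta> / 2\<close> of
    \<open>y\<close> are less than \<open>\<delta>\<close> apart, hence share a centre. That centre
    decides which of the distances vanish at \<open>y\<close>.\<close>
  have point: "\<exists>c. \<forall>B. \<phi> m B y = 0 \<longleftrightarrow> c \<in> B" if y: "\<phi> m UNIV y = 0" for y
  proof -
    obtain a where a: "a \<in> A m" "d y a < \<delta> / 2"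
      using y dist_to_lessD[of "A m" y "\<delta> / 2"] \<delta> by (auto simp: \<phi>_def)
    have near: "\<pi> b = \<pi> a" if "b \<in> A m" "d y b < \<delta> / 2" for b
    proof (rule sep[OF that(1) a(1)])
      show "d b a < inverse (Suc m)"
        using metric.triangle[of b y a] metric.commute[of b y] a that by (simp add: \<delta>_def)
    qed
    have "\<phi> m B y = 0 \<longleftrightarrow> \<pi> a \<in> B" for B
    proof
      assume "\<phi> m B y = 0"
      then obtain b where "b \<in> A m \<inter> \<pi> -` B" "d y b < \<delta> / 2"
        using dist_to_lessD[of "A m \<inter> \<pi> -` B" y "\<delta> / 2"] \<delta> by (auto simp: \<phi>_def)
      then show "\<pi> a \<in> B"
        using near[of b] by auto
    next
      assume B: "\<pi> a \<in> B"
      have "\<phi> m B y \<le> 0 + e" if e: "e > 0" for e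
      proof -
        have "min e (\<delta> / 2) \<le> 1"
          using \<delta> by linarith
        then obtain b where b: "b \<in> A m" "d y b < min e (\<delta> / 2)"
          using y dist_to_lessD[of "A m" y "min e (\<delta> / 2)"] \<delta> e by (auto simp: \<phi>_def)
        then have "b \<in> A m \<inter> \<pi> -` B"
          using near[of b] B by simp
        from dist_to_le[OF this, of y] b(2) show ?thesis
          by (simp add: \<phi>_def)
      qed
      then have "\<phi> m B y \<le> 0"
        by (rule field_le_epsilon)
      then show "\<phi> m B y = 0"
        using dist_to_nonneg[of "A m \<inter> \<pi> -` B" y] by (simp add: \<phi>_def)
    qed
    then show ?thesis by blast
  qed
  define F where "F B \<longleftrightarrow> p (\<phi> m B) = 0" for B
  \<comment> \<open>Any countable part of \<open>F\<close> looks like membership of a single point;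
    the ultrafilter axioms all reduce to this. Slot \<open>0\<close> of \<open>g\<close> forces
    \<open>y\<close> into the closure of \<open>A m\<close> for the metric.\<close>
  have countable_point: "\<exists>c. \<forall>n. F (B n) \<longleftrightarrow> c \<in> B n" for B :: "nat \<Rightarrow> 'a set"
  proof -
    define g where "g n = (case n of 0 \<Rightarrow> \<phi> m UNIV | Suc n \<Rightarrow> \<phi> m (B n))" for n
    have "continuous_on Y (g n)" for n
      using cont by (simp add: g_def split: nat.split)
    then obtain y where y: "\<And>n. g n y = p (g n)"
      using cip[of g] by blast
    have "\<phi> m UNIV y = 0" "\<And>n. F (B n) \<longleftrightarrow> \<phi> m (B n) y = 0"
      using y[of 0] y[of "Suc n" for n] m by (simp_all add: F_def g_def)
    then show ?thesis
      using point by metis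
  qed
  have pair: "\<exists>c. (F B \<longleftrightarrow> c \<in> B) \<and> (F C \<longleftrightarrow> c \<in> C)" for B C
  proof -
    obtain c where c: "\<forall>n::nat. F (if n = 0 then B else C) \<longleftrightarrow> c \<in> (if n = 0 then B else C)"
      using countable_point[of "\<lambda>n. if n = 0 then B else C"] ..
    show ?thesis
      using c[rule_format, of 0] c[rule_format, of 1] by auto
  qed
  have "sigma_ultrafilter UNIV F"
  proof
    show "F UNIV" using m by (simp add: F_def)
    show "\<not> F {}" using countable_point[of "\<lambda>_. {}"] by simp
    show "F C" if "F B" "B \<subseteq> C" for B C
      using pair[of B C] that by blast
    show "F (\<Inter>n. B n)" if B: "\<And>n::nat. F (B n)" for B
    proof -
      define C where "C n = (case n of 0 \<Rightarrow> \<Inter>n. B n | Suc n \<Rightarrow> B n)" for n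
      obtain c where c: "\<And>n. F (C n) \<longleftrightarrow> c \<in> C n"
        using countable_point[of C] by blast
      show ?thesis
        using c[of 0] c[of "Suc n" for n] B by (simp add: C_def)
    qed
    show "F B \<or> F (UNIV - B)" for B
      using pair[of B "UNIV - B"] by blast
  qed simp
  then obtain c where "F {c}"
    using not_ulam unfolding ulam_measurable_card_of by blast
  have "continuous_on Y (\<lambda>z. max 0 (d c z - \<epsilon>))"
    by (intro continuous_intros continuous_on_subset[OF continuous_d]) simp
  \<comment> \<open>Slot \<open>0\<close> places \<open>y\<close> near a point with centre
    \<open>c\<close>; the later slots make the same \<open>y\<close> compute the value of
    \<open>p\<close> at the target function.\<close>
  then have "continuous_on Y (case n of 0 \<Rightarrow> \<phi> m {c} | Suc _ \<Rightarrow> (\<lambda>z. max 0 (d c z - \<epsilon>)))" for n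
    using cont by (simp split: nat.split)
  from cip[of "case_nat (\<phi> m {c}) (\<lambda>_ z. max 0 (d c z - \<epsilon>))", OF this]
  obtain y where y: "\<forall>n. case_nat (\<phi> m {c}) (\<lambda>_ z. max 0 (d c z - \<epsilon>)) n y =
      p (case_nat (\<phi> m {c}) (\<lambda>_ z. max 0 (d c z - \<epsilon>)) n)"
    by (elim bexE)
  have "dist_to (A m \<inter> \<pi> -` {c}) y = 0"
    using y[rule_format, of 0] \<open>F {c}\<close> by (simp add: F_def \<phi>_def)
  then obtain a where a: "a \<in> A m" "\<pi> a = c" "d y a < \<delta>"
    using dist_to_lessD[of "A m \<inter> \<pi> -` {c}" y \<delta>] \<delta> by auto
  have "d c y \<le> d a c + d y a"
    using metric.triangle[of c a y] metric.commute[of a c] metric.commute[of a y] by simp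
  also have "\<dots> < \<epsilon>"
    using A[OF a(1)] a by (simp add: \<delta>_def)
  finally show ?thesis
    using y[rule_format, of "Suc 0"] by (intro exI[of _ c]) simp
qed

text \<open>The closed balls given by \<open>small_ball\<close> for radii tending to
  \<open>0\<close> share at most one point. Adding any \<open>f\<close> to this countable list of
  conditions yields a common point where \<open>f\<close> agrees with \<open>p\<close>, and
  uniqueness makes it the same point for all \<open>f\<close>.\<close>

lemma limit_of_evaluations_eq_evaluation:
  fixes Y :: "'a set" and p :: "('a \<Rightarrow> real) \<Rightarrow> real"
  assumes cip: "\<And>f. (\<And>n::nat. continuous_on Y (f n)) \<Longrightarrow> \<exists>y\<in>Y. \<forall>n. f n y = p (f n)"
    and not_ulam: "\<not> ulam_measurable |UNIV :: 'a set|"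
  shows "\<exists>y\<in>Y. \<forall>f. continuous_on Y f \<longrightarrow> f y = p f"
proof -
  have "\<exists>c. p (\<lambda>z. max 0 (d c z - inverse (Suc n))) = 0" for n
    using small_ball[OF cip not_ulam, of "inverse (Suc n)"] by simp
  then obtain c where c: "\<And>n. p (\<lambda>z. max 0 (d (c n) z - inverse (Suc n))) = 0"
    by metis
  have cont: "continuous_on Y (\<lambda>z. max 0 (d (c n) z - inverse (Suc n)))" for n
    by (intro continuous_intros continuous_on_subset[OF continuous_d]) simp
  have ex: "\<exists>y\<in>Y. f y = p f \<and> (\<forall>n. d (c n) y \<le> inverse (Suc n))" if f: "continuous_on Y f" for f
  proof -
    define g where "g n = (case n of 0 \<Rightarrow> f | Suc n \<Rightarrow> (\<lambda>z. max 0 (d (c n) z - inverse (Suc n))))" for n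
    have "continuous_on Y (g n)" for n
      using cont f by (simp add: g_def split: nat.split)
    then obtain y where y: "y \<in> Y" "\<And>n. g n y = p (g n)"
      using cip[of g] by blast
    have "d (c n) y \<le> inverse (Suc n)" for n
      using y(2)[of "Suc n"] c[of n] by (simp add: g_def max_def split: if_splits)
    then show ?thesis
      using y(1) y(2)[of 0] by (auto simp: g_def)
  qed
  have unique: "x = y"
    if x: "\<And>n. d (c n) x \<le> inverse (Suc n)" and y: "\<And>n. d (c n) y \<le> inverse (Suc n)" for x y
  proof (rule ccontr)
    assume "x \<noteq> y"
    then have "d x y / 2 > 0"
      using metric.mdist_pos_less[of x y] by simp
    then obtain n where "inverse (Suc n) < d x y / 2"
      using reals_Archimedean by blast
    moreover have "d x y \<le> d (c n) x + d (c n) y"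
      using metric.triangle[of x "c n" y] metric.commute[of x "c n"] by simp
    ultimately show False
      using x[of n] y[of n] by simp
  qed
  obtain y where "y \<in> Y" "\<And>n. d (c n) y \<le> inverse (Suc n)"
    using ex[of "\<lambda>_. 0"] by auto
  with ex unique show ?thesis
    by metis
qed

end

text \<open>Embed \<open>Y\<close> by all its continuous real functions. A point in the closure of
  the image is a limit of evaluations, and the preceding lemmas turn it into an evaluation at a
  point of \<open>Y\<close>.\<close>

lemma realcompact_subspace:
  fixes Y :: "'a::topological_group_add set"
  assumes cps: "countable_pseudocharacter (euclidean :: 'a::topological_group_add topology)"
    and not_ulam: "\<not> ulam_measurable |UNIV :: 'a::topological_group_add set|"
  shows "realcompact_space (top_of_set Y)"
proof -
  obtain N :: "'a \<Rightarrow> real" where "continuous_norm N"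
    using ex_continuous_norm[OF cps] ..
  then interpret continuous_norm N .
  define I where "I = {f :: 'a \<Rightarrow> real. continuous_on Y f}"
  define e where "e y = (\<lambda>f\<in>I. f y)" for y
  have e_top: "e ` Y \<subseteq> topspace (powertop_real I)"
    by (auto simp: e_def)
  have closed: "closedin (powertop_real I) (e ` Y)"
    unfolding closure_of_subset_eq[symmetric]
  proof (intro conjI e_top subsetI)
    fix p assume "p \<in> powertop_real I closure_of (e ` Y)"
    then have p_top: "p \<in> topspace (powertop_real I)"
      and p: "\<And>T. p \<in> T \<Longrightarrow> openin (powertop_real I) T \<Longrightarrow> \<exists>y\<in>Y. e y \<in> T"
      by (auto simp: in_closure_of)
    have "\<exists>y\<in>Y. \<forall>g\<in>J. \<bar>g y - p g\<bar> < \<epsilon>"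
      if J: "finite J" "\<And>g. g \<in> J \<Longrightarrow> continuous_on Y g" and \<epsilon>: "\<epsilon> > 0" for J \<epsilon>
    proof -
      let ?U = "\<lambda>g. if g \<in> J then ball (p g) \<epsilon> else UNIV"
      have "{g \<in> I. ?U g \<noteq> topspace euclideanreal} \<subseteq> J"
        by auto
      then have "openin (powertop_real I) (Pi\<^sub>E I ?U)"
        using J(1) by (auto simp: openin_PiE_gen intro: finite_subset)
      moreover have "p \<in> Pi\<^sub>E I ?U"
        using p_top \<epsilon> by (auto simp: PiE_def)
      ultimately obtain y where y: "y \<in> Y" "e y \<in> Pi\<^sub>E I ?U"
        using p by blast
      have "\<bar>g y - p g\<bar> < \<epsilon>" if "g \<in> J" for g
      proof -
        have "g \<in> I"
          using J(2) that by (simp add: I_def)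
        then show ?thesis
          using PiE_mem[OF y(2), of g] that by (simp add: e_def dist_real_def abs_minus_commute)
      qed
      with y(1) show ?thesis by blast
    qed
    from limit_of_evaluations_countable[of Y p, OF this]
    obtain y where y: "y \<in> Y" "\<And>f. continuous_on Y f \<Longrightarrow> f y = p f"
      using limit_of_evaluations_eq_evaluation[of Y p, OF _ not_ulam] by blast
    have "p = e y"
      using p_top y(2) by (auto simp: e_def I_def PiE_def extensional_def fun_eq_iff)
    with y(1) show "p \<in> e ` Y" by blast
  qed
  have I_UNIV: "f \<in> I" if "continuous_on UNIV f" for f
    using that continuous_on_subset by (auto simp: I_def)
  have "homeomorphic_map (top_of_set Y) (subtopology (powertop_real I) (e ` Y)) e"
  proof (rule bijective_open_imp_homeomorphic_map)
    show "continuous_map (top_of_set Y) (subtopology (powertop_real I) (e ` Y)) e"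
      unfolding continuous_map_in_subtopology
      by (auto simp: e_def I_def continuous_map_componentwise)
    show "open_map (top_of_set Y) (subtopology (powertop_real I) (e ` Y)) e"
      unfolding open_map_def
    proof (intro allI impI)
      fix U assume U: "openin (top_of_set Y) U"
      then obtain W where W: "open W" "U = Y \<inter> W"
        unfolding openin_open by blast
      show "openin (subtopology (powertop_real I) (e ` Y)) (e ` U)"
        unfolding openin_subopen[of _ "e ` U"]
      proof
        fix x assume "x \<in> e ` U"
        then obtain y where y: "y \<in> U" "x = e y" by blast
        \<comment> \<open>The metric \<open>d\<close> may induce a coarser topology, so openness
          uses a seminorm \<open>M\<close> adapted to \<open>W\<close>; \<open>d\<close> serves for
          injectivity below.\<close>
        have "open {u. y + u \<in> W}" "0 \<in> {u. y + u \<in> W}"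
          using W y open_translation_vimage(1) by auto
        then obtain M :: "'a \<Rightarrow> real" and \<epsilon> where M: "continuous_seminorm M"
          and \<epsilon>: "\<epsilon> > 0" "\<And>u. M u < \<epsilon> \<Longrightarrow> y + u \<in> W"
          using continuous_seminorm_in_nbhds[of "\<lambda>_. {u. y + u \<in> W}"] by auto
        interpret M: continuous_seminorm M by fact
        define g where "g = (\<lambda>z. M (- y + z))"
        have g: "g \<in> I"
          unfolding g_def by (rule I_UNIV[OF M.continuous_translation])
        define T where "T = {z \<in> topspace (powertop_real I). z g \<in> {..<\<epsilon>}}"
        have "openin (powertop_real I) T"
          unfolding T_def by (rule openin_continuous_map_preimage
            [OF continuous_map_product_projection[OF g]]) simp
        moreover have "e y \<in> T"
          using g \<epsilon>(1) M.zero by (simp add: T_def e_def g_def)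
        moreover have "T \<inter> e ` Y \<subseteq> e ` U"
        proof
          fix t assume "t \<in> T \<inter> e ` Y"
          then obtain z where z: "z \<in> Y" "t = e z" "g z < \<epsilon>"
            using g by (auto simp: T_def e_def)
          then have "z \<in> W"
            using \<epsilon>(2)[of "- y + z"] by (simp add: g_def add.assoc[symmetric] del: add_uminus_conv_diff)
          with z W show "t \<in> e ` U" by blast
        qed
        ultimately show "\<exists>T. openin (subtopology (powertop_real I) (e ` Y)) T \<and> x \<in> T \<and> T \<subseteq> e ` U"
          using y W by (intro exI[of _ "T \<inter> e ` Y"]) (auto simp: openin_subtopology)
      qed
    qed
    show "e ` topspace (top_of_set Y) = topspace (subtopology (powertop_real I) (e ` Y))"
      using e_top by auto
    show "inj_on e (topspace (top_of_set Y))"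
    proof (rule inj_onI)
      fix x y assume "e x = e y"
      then have "e x (d x) = e y (d x)" by simp
      then have "d x x = d x y"
        using I_UNIV[OF continuous_d] by (simp add: e_def)
      then show "x = y" by simp
    qed
  qed
  then show ?thesis
    unfolding realcompact_space_def
    using closed homeomorphic_map_imp_homeomorphic_space by blast
qed

section \<open>Locally precompact groups\<close>

text \<open>One-sided, with centres anywhere: this follows from \<open>precompact\<close>, survives
  left translation, and suffices for counting covers.\<close>

definition totally_bounded :: "'a::topological_group_add set \<Rightarrow> bool" where
  "totally_bounded W \<longleftrightarrow> (\<forall>V. open V \<and> 0 \<in> V \<longrightarrow> (\<exists>S. finite S \<and> W \<subseteq> S + V))"

text \<open>
  The counting argument behind Haar measure: in a cover of \<open>W\<close> by the least possible number \<open>n\<close> of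
  small translates, each \<open>Q i\<close> uses up at least \<open>n / card (T i)\<close> of them.
\<close>

lemma sum_inverse_covering_number_le_1:
  fixes W :: "'a::topological_group_add set"
  assumes W: "totally_bounded W" "W \<noteq> {}" and J: "finite J"
    and V: "\<And>i. i \<in> J \<Longrightarrow> open (V i)" "\<And>i. i \<in> J \<Longrightarrow> 0 \<in> V i"
    and T: "\<And>i. i \<in> J \<Longrightarrow> finite (T i)" "\<And>i. i \<in> J \<Longrightarrow> W \<subseteq> T i + V i"
    and Q: "\<And>i u v. i \<in> J \<Longrightarrow> u \<in> V i \<Longrightarrow> v \<in> V i \<Longrightarrow> x i + u + v \<in> Q i"
      "\<And>i. i \<in> J \<Longrightarrow> Q i \<subseteq> W" "disjoint_family_on Q J"
  shows "(\<Sum>i\<in>J. 1 / real (card (T i))) \<le> 1"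
proof -
  have "open (\<Inter>i\<in>J. V i)" "0 \<in> (\<Inter>i\<in>J. V i)"
    using J V by auto
  then obtain V0 where V0: "open V0" "0 \<in> V0" "\<And>u. u \<in> V0 \<Longrightarrow> - u \<in> V0"
    "\<And>u v w. u \<in> V0 \<Longrightarrow> v \<in> V0 \<Longrightarrow> w \<in> V0 \<Longrightarrow> u + v + w \<in> (\<Inter>i\<in>J. V i)"
    by (rule nbhd_triple) blast
  have V0_sub: "u \<in> V i" if "u \<in> V0" "i \<in> J" for u i
    using V0(4)[of u 0 0] V0(2) that by auto
  define cover where "cover S \<longleftrightarrow> finite S \<and> W \<subseteq> S + V0" for S
  have "\<exists>S. cover S"
    using W(1) V0(1,2) unfolding totally_bounded_def cover_def by blast
  then obtain S where S: "cover S" and least: "\<And>S'. cover S' \<Longrightarrow> card S \<le> card S'"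
    using ex_has_least_nat[of cover _ card] by blast
  have finS: "finite S" and WS: "W \<subseteq> S + V0"
    using S by (auto simp: cover_def)
  have "S \<noteq> {}"
    using WS W(2) by auto
  then have n: "card S > 0"
    using finS by (simp add: card_gt_0_iff)
  have big: "card S \<le> card (T i) * card (S \<inter> Q i)" if i: "i \<in> J" for i
  proof -
    \<comment> \<open>Since \<open>x i + V i\<close> lies in \<open>Q i\<close>, it is covered by
      translates centred in \<open>S\<close>; by symmetry of \<open>V0\<close>, these centres
      \<open>s = x i + v - u\<close> are in \<open>Q i\<close>. Moving this cover to every
      \<open>t + V i\<close> covers \<open>W\<close>.\<close>
    define R where "R = (\<lambda>(t, s). t + (- x i + s)) ` (T i \<times> (S \<inter> Q i))"
    have "W \<subseteq> R + V0"
    proof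
      fix w assume "w \<in> W"
      then obtain t v where tv: "t \<in> T i" "v \<in> V i" "w = t + v"
        using T(2)[OF i] by (blast elim: set_plus_elim)
      have "x i + v + 0 \<in> Q i"
        using Q(1)[OF i tv(2)] V(2)[OF i] by blast
      then have "x i + v \<in> W"
        using Q(2)[OF i] by auto
      then obtain s u where su: "s \<in> S" "u \<in> V0" "x i + v = s + u"
        using WS by (blast elim: set_plus_elim)
      then have s: "s = x i + v + - u"
        by (simp add: add.assoc)
      then have "s \<in> Q i"
        using Q(1)[OF i tv(2)] V0_sub[OF V0(3) i] su by metis
      moreover have "w = (t + (- x i + s)) + u"
        unfolding tv(3) s by (simp only: add.assoc minus_add_cancel left_minus add_0_right)
      ultimately show "w \<in> R + V0"
        using tv(1) su by (auto simp: R_def intro!: set_plus_intro)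
    qed
    moreover have "finite R"
      using T(1)[OF i] finS by (simp add: R_def)
    ultimately have "card S \<le> card R"
      by (intro least) (simp add: cover_def)
    also have "\<dots> \<le> card (T i) * card (S \<inter> Q i)"
      unfolding R_def using T(1)[OF i] finS by (metis card_cartesian_product card_image_le finite_Int finite_SigmaI)
    finally show ?thesis .
  qed
  have "(\<Sum>i\<in>J. real (card S) * (1 / card (T i))) \<le> (\<Sum>i\<in>J. real (card (S \<inter> Q i)))"
  proof (rule sum_mono)
    fix i assume "i \<in> J"
    then have "real (card S) \<le> real (card (T i)) * real (card (S \<inter> Q i))"
      using big of_nat_mono by fastforce
    moreover have "real (card (T i)) > 0"
      using big[OF \<open>i \<in> J\<close>] n by (cases "card (T i) = 0") auto
    ultimately show "real (card S) * (1 / card (T i)) \<le> real (card (S \<inter> Q i))"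
      by (simp add: field_simps)
  qed
  also have "\<dots> = real (card (\<Union>i\<in>J. S \<inter> Q i))"
    using J finS Q(3) by (subst card_UN_disjoint) (auto simp: disjoint_family_on_def)
  also have "\<dots> \<le> real (card S)"
    using finS by (intro of_nat_mono card_mono) auto
  finally show ?thesis
    using n by (simp flip: sum_distrib_left del: times_divide_eq_right mult_1_right)
qed

text \<open>By the preceding bound, at most \<open>k\<close> indices have
  \<open>card (T i) \<le> k\<close>, so \<open>J\<close> is a countable union of finite
  sets.\<close>

lemma countable_disjoint_family:
  fixes W :: "'a::topological_group_add set"
  assumes W: "totally_bounded W"
    and V: "\<And>i. i \<in> J \<Longrightarrow> open (V i)" "\<And>i. i \<in> J \<Longrightarrow> 0 \<in> V i"
    and Q: "\<And>i u v. i \<in> J \<Longrightarrow> u \<in> V i \<Longrightarrow> v \<in> V i \<Longrightarrow> x i + u + v \<in> Q i"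
      "\<And>i. i \<in> J \<Longrightarrow> Q i \<subseteq> W" "disjoint_family_on Q J"
  shows "countable J"
proof (cases "J = {}")
  case False
  then have W_ne: "W \<noteq> {}"
    using V(2) Q(1,2) by blast
  have "\<exists>T. finite T \<and> W \<subseteq> T + V i" if "i \<in> J" for i
    using W V that unfolding totally_bounded_def by blast
  then obtain T where T: "\<And>i. i \<in> J \<Longrightarrow> finite (T i)" "\<And>i. i \<in> J \<Longrightarrow> W \<subseteq> T i + V i"
    by metis
  have T_pos: "card (T i) > 0" if "i \<in> J" for i
    using T[OF that] W_ne by (auto simp: card_gt_0_iff)
  have "finite {i \<in> J. card (T i) \<le> k}" for k
  proof (rule finite_if_finite_subsets_card_bdd[of _ k, THEN conjunct1])
    fix K assume K: "K \<subseteq> {i \<in> J. card (T i) \<le> k}" "finite K"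
    have "(\<Sum>i\<in>K. 1 / real k) \<le> (\<Sum>i\<in>K. 1 / real (card (T i)))"
      using K(1) T_pos by (force intro!: sum_mono divide_left_mono)
    also have "\<dots> \<le> 1"
      using K by (intro sum_inverse_covering_number_le_1[OF W W_ne K(2), of V T x Q] V T Q(1,2)
        disjoint_family_on_mono[OF _ Q(3)]) auto
    finally show "card K \<le> k"
      using K T_pos by (cases "k = 0") (force simp: divide_simps)+
  qed
  then have "countable (\<Union>k. {i \<in> J. card (T i) \<le> k})"
    by (intro countable_UN) (auto intro: countable_finite)
  moreover have "J = (\<Union>k. {i \<in> J. card (T i) \<le> k})"
    by auto
  ultimately show ?thesis
    by simp
qed simp

text \<open>Zorn's lemma. An empty \<open>Q i\<close> meets nothing, not even itself, hence the side
  condition.\<close>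

lemma ex_maximal_disjoint_subset:
  fixes P :: "'i set" and Q :: "'i \<Rightarrow> 'b set"
  shows "\<exists>M\<subseteq>P. disjoint_family_on Q M \<and> (\<forall>i\<in>P. Q i \<noteq> {} \<longrightarrow> (\<exists>j\<in>M. Q i \<inter> Q j \<noteq> {}))"
proof -
  have "\<exists>M\<in>{M. M \<subseteq> P \<and> disjoint_family_on Q M}. \<forall>X\<in>{M. M \<subseteq> P \<and> disjoint_family_on Q M}.
      M \<subseteq> X \<longrightarrow> X = M"
  proof (rule subset_Zorn')
    fix C assume C: "subset.chain {M. M \<subseteq> P \<and> disjoint_family_on Q M} C"
    then have sub: "\<And>M. M \<in> C \<Longrightarrow> M \<subseteq> P \<and> disjoint_family_on Q M"
      by (auto simp: subset.chain_def)
    have "disjoint_family_on Q (\<Union>C)"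
      unfolding disjoint_family_on_def
    proof (intro ballI impI)
      fix i j assume "i \<in> \<Union>C" "j \<in> \<Union>C" and ij: "i \<noteq> j"
      then obtain A B where "A \<in> C" "B \<in> C" "i \<in> A" "j \<in> B"
        by blast
      moreover from this have "A \<subseteq> B \<or> B \<subseteq> A"
        using C by (auto simp: subset_chain_def)
      ultimately obtain D where "D \<in> C" "i \<in> D" "j \<in> D"
        by blast
      with sub ij show "Q i \<inter> Q j = {}"
        unfolding disjoint_family_on_def by blast
    qed
    with sub show "\<Union>C \<in> {M. M \<subseteq> P \<and> disjoint_family_on Q M}"
      by blast
  qed
  then obtain M where M: "M \<subseteq> P" "disjoint_family_on Q M"
    and max: "\<forall>X\<in>{M. M \<subseteq> P \<and> disjoint_family_on Q M}. M \<subseteq> X \<longrightarrow> X = M"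
    by (elim bexE CollectE conjE)
  have "\<exists>j\<in>M. Q i \<inter> Q j \<noteq> {}" if i: "i \<in> P" "Q i \<noteq> {}" for i
  proof (rule ccontr)
    assume *: "\<not> ?thesis"
    then have "disjoint_family_on Q (insert i M)"
      using M(2) unfolding disjoint_family_on_def by blast
    then have "insert i M = M"
      using max[rule_format, of "insert i M"] M(1) i by auto
    with * i show False by blast
  qed
  with M show ?thesis
    by (intro exI[of _ M]) simp
qed

text \<open>
  Spaces in which this holds at every point are called Moscow spaces. A maximal disjoint family of
  sets \<open>y + V + V\<close> with \<open>y + V + V + V \<subseteq> U\<close> is countable, and its union, which is dense in \<open>U\<close>, stays
  in \<open>U\<close> under right translation by elements of all the \<open>V\<close>.
\<close>

lemma gdelta_subset_closure:
  fixes U W :: "'a::topological_group_add set"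
  assumes W: "totally_bounded W" "open W" "x \<in> W" and U: "open U" "x \<in> closure U"
  shows "\<exists>P. gdelta_in euclidean P \<and> x \<in> P \<and> P \<subseteq> closure U"
proof -
  define P where "P = {(y, V). open V \<and> 0 \<in> V \<and> (\<forall>u\<in>V. \<forall>v\<in>V. \<forall>w\<in>V. y + u + v + w \<in> U \<inter> W)}"
  define Q where "Q = (\<lambda>(y, V). {y + u + v | u v :: 'a. u \<in> V \<and> v \<in> V})"
  obtain M where M: "M \<subseteq> P" "disjoint_family_on Q M"
    "\<And>i. i \<in> P \<Longrightarrow> Q i \<noteq> {} \<Longrightarrow> \<exists>j\<in>M. Q i \<inter> Q j \<noteq> {}"
    using ex_maximal_disjoint_subset[of P Q] by (elim exE conjE) simp
  have M_V: "open V" "0 \<in> V" "\<And>u v w. u \<in> V \<Longrightarrow> v \<in> V \<Longrightarrow> w \<in> V \<Longrightarrow> y + u + v + w \<in> U \<inter> W"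
    if "(y, V) \<in> M" for y V
    using that M(1) by (auto simp: P_def)
  have "countable M"
  proof (rule countable_disjoint_family[OF W(1), of M snd fst Q])
    show "fst i + u + v \<in> Q i" if "i \<in> M" "u \<in> snd i" "v \<in> snd i" for i u v
      using that by (cases i) (auto simp: Q_def)
    show "Q i \<subseteq> W" if "i \<in> M" for i
    proof
      fix z assume "z \<in> Q i"
      then obtain y V u v where "i = (y, V)" "z = y + u + v" "u \<in> V" "v \<in> V"
        by (auto simp: Q_def split: prod.splits)
      with M_V(2,3)[of y V] that show "z \<in> W"
        by (metis IntD2 add_0_right)
    qed
  qed (use M_V M(2) in auto)
  have dense: "\<exists>j\<in>M. G \<inter> Q j \<noteq> {}" if G: "open G" "G \<subseteq> U \<inter> W" "G \<noteq> {}" for G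
  proof -
    obtain y where "y \<in> G" using G by blast
    then have "open {u. y + u \<in> G}" "0 \<in> {u. y + u \<in> G}"
      using open_translation_vimage(1)[OF G(1)] by auto
    then obtain V where V: "open V" "0 \<in> V" "\<And>u. u \<in> V \<Longrightarrow> - u \<in> V"
      "\<And>u v w. u \<in> V \<Longrightarrow> v \<in> V \<Longrightarrow> w \<in> V \<Longrightarrow> u + v + w \<in> {u. y + u \<in> G}"
      by (rule nbhd_triple) blast
    have VG: "y + u + v + w \<in> G" if "u \<in> V" "v \<in> V" "w \<in> V" for u v w
      using V(4)[OF that] by (simp add: add.assoc)
    have "(y, V) \<in> P"
      using V(1,2) VG G(2) unfolding P_def by blast
    moreover have "Q (y, V) \<subseteq> G"
    proof
      fix z assume "z \<in> Q (y, V)"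
      then obtain u v where "z = y + u + v" "u \<in> V" "v \<in> V"
        by (auto simp: Q_def)
      with VG[of u v 0] V(2) show "z \<in> G" by simp
    qed
    moreover have "Q (y, V) \<noteq> {}"
      using V(2) by (auto simp: Q_def)
    ultimately show ?thesis
      using M(3) by blast
  qed
  \<comment> \<open>The intersection of the \<open>x + V\<close> over all chosen pairs; inserting
    \<open>UNIV\<close> keeps the family nonempty without a case distinction.\<close>
  define R where "R = \<Inter>(insert UNIV ((\<lambda>i. {y. - x + y \<in> snd i}) ` M))"
  have "gdelta_in euclidean R"
    unfolding R_def
  proof (rule gdelta_in_Inter)
    show "countable (insert UNIV ((\<lambda>i. {y. - x + y \<in> snd i}) ` M))"
      using \<open>countable M\<close> by simp
    show "gdelta_in euclidean T" if "T \<in> insert UNIV ((\<lambda>i. {y. - x + y \<in> snd i}) ` M)" for T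
      using that M_V(1) by (intro open_imp_gdelta_in) (auto simp del: uminus_add_conv_diff intro!: open_translation_vimage)
  qed simp
  moreover have "x \<in> R"
    using M_V(2) by (auto simp: R_def)
  moreover have "R \<subseteq> closure U"
  proof
    fix y assume y: "y \<in> R"
    define u where "u = - x + y"
    have y_eq: "y = x + u"
      by (simp add: u_def add.assoc[symmetric])
    show "y \<in> closure U"
      unfolding closure_iff_nhds_not_empty
    proof (intro allI impI)
      fix A G assume "G \<subseteq> A" "open G" "y \<in> G"
      \<comment> \<open>Points of \<open>U\<close> near \<open>x\<close> whose right translate by
        \<open>u\<close> falls into \<open>G\<close>. By density one of them lies in some
        \<open>Q j\<close>, and since \<open>u\<close> is in the corresponding \<open>V\<close>, its
        translate stays in \<open>U\<close>.\<close>
      define H where "H = {z. z + u \<in> G} \<inter> W \<inter> U"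
      have H0: "open ({z. z + u \<in> G} \<inter> W)" "x \<in> {z. z + u \<in> G} \<inter> W"
        using \<open>open G\<close> \<open>y \<in> G\<close> W y_eq open_translation_vimage(2) by auto
      then have "H \<noteq> {}"
        using U(2) closure_iff_nhds_not_empty[of x U] unfolding H_def by (metis inf.idem inf_commute subset_refl)
      moreover have "open H"
        unfolding H_def using H0(1) U(1) by blast
      ultimately obtain j where j: "j \<in> M" "H \<inter> Q j \<noteq> {}"
        using dense[of H] unfolding H_def by blast
      obtain y' V where yV: "j = (y', V)" by (cases j)
      then obtain a b where ab: "a \<in> V" "b \<in> V" "y' + a + b \<in> H"
        using j(2) by (auto simp: Q_def)
      have "u \<in> V"
        using y j(1) yV by (auto simp: R_def u_def)
      then have "y' + a + b + u \<in> U"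
        using M_V(3)[of y' V] j yV ab by blast
      moreover have "y' + a + b + u \<in> G"
        using ab(3) by (simp add: H_def)
      ultimately show "U \<inter> A \<noteq> {}"
        using \<open>G \<subseteq> A\<close> by blast
    qed
  qed
  ultimately show ?thesis
    by blast
qed

text \<open>If \<open>x\<close> is in the closures of countably many open sets, the Moscow property
  gives a G_delta set around \<open>x\<close> inside all of them, and it contains a second point
  \<open>y\<close>. The value \<open>f y\<close> is then contradictory both when \<open>f\<close> is
  unbounded near \<open>x\<close> and when it oscillates across a gap \<open>a < b\<close>.\<close>

lemma tendsto_at_non_gdelta_point:
  fixes W :: "'a::{topological_group_add, t2_space} set" and f :: "'a \<Rightarrow> real"
  assumes W: "totally_bounded W" "open W" "x \<in> W" and x: "\<not> gdelta_in euclidean {x}"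
    and f: "continuous_on (- {x}) f"
  shows "\<exists>l. (f \<longlongrightarrow> l) (at x)"
proof -
  define lt where "lt a = {y \<in> - {x}. f y < a}" for a
  define gt where "gt a = {y \<in> - {x}. f y > a}" for a
  have open_lt: "open (lt a)" and open_gt: "open (gt a)" for a
    unfolding lt_def gt_def
    using continuous_open_preimage[OF f, of "{..<a}"] continuous_open_preimage[OF f, of "{a<..}"]
    by (auto simp: Int_def vimage_def)
  have closure_lt: "f y \<le> a" if y: "y \<in> closure (lt a)" "y \<noteq> x" for y a
  proof (rule ccontr)
    assume "\<not> f y \<le> a"
    then have "gt a \<inter> lt a \<noteq> {}"
      using y open_gt[of a] open_Int_closure_eq_empty[of "gt a" "lt a"] by (auto simp: gt_def)
    then show False by (auto simp: gt_def lt_def)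
  qed
  have closure_gt: "f y \<ge> a" if y: "y \<in> closure (gt a)" "y \<noteq> x" for y a
  proof (rule ccontr)
    assume "\<not> f y \<ge> a"
    then have "lt a \<inter> gt a \<noteq> {}"
      using y open_lt[of a] open_Int_closure_eq_empty[of "lt a" "gt a"] by (auto simp: lt_def)
    then show False by (auto simp: gt_def lt_def)
  qed
  have common: "\<exists>y. y \<noteq> x \<and> (\<forall>n. y \<in> closure (U n))"
    if U: "\<And>n::nat. open (U n)" "\<And>n. x \<in> closure (U n)" for U
  proof -
    obtain P where P: "\<And>n. gdelta_in euclidean (P n)" "\<And>n. x \<in> P n" "\<And>n. P n \<subseteq> closure (U n)"
      using gdelta_subset_closure[OF W U] by metis
    have "gdelta_in euclidean (\<Inter>(range P))"
      using P(1) by (intro gdelta_in_Inter) auto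
    then have "\<Inter>(range P) \<noteq> {x}"
      using x by metis
    then obtain y where "y \<noteq> x" "\<And>n. y \<in> P n"
      using P(2) by blast
    with P(3) show ?thesis by blast
  qed
  have no_oscillation: "\<not> (x \<in> closure (lt a) \<and> x \<in> closure (gt b))" if "a < b" for a b
  proof
    assume "x \<in> closure (lt a) \<and> x \<in> closure (gt b)"
    then have "\<exists>y. y \<noteq> x \<and> (\<forall>n::nat. y \<in> closure (if n = 0 then lt a else gt b))"
      using open_lt open_gt by (intro common) auto
    then obtain y where y: "y \<noteq> x" "\<forall>n::nat. y \<in> closure (if n = 0 then lt a else gt b)"
      by (elim exE conjE)
    show False
      using closure_lt[of y a] closure_gt[of y b] y(1) y(2)[rule_format, of 0]
        y(2)[rule_format, of 1] \<open>a < b\<close> by simp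
  qed
  have "\<exists>n::nat. x \<notin> closure (gt (real n))"
  proof (rule ccontr)
    assume "\<not> ?thesis"
    then obtain y where y: "y \<noteq> x" "\<And>n::nat. y \<in> closure (gt (real n))"
      using common[of "\<lambda>n. gt (real n)"] open_gt by blast
    obtain n where "f y < real n"
      using reals_Archimedean2 by blast
    with closure_gt[OF y(2) y(1), of n] show False by simp
  qed
  then obtain u where u: "x \<notin> closure (gt u)" by blast
  have "\<exists>n::nat. x \<notin> closure (lt (- real n))"
  proof (rule ccontr)
    assume "\<not> ?thesis"
    then obtain y where y: "y \<noteq> x" "\<And>n::nat. y \<in> closure (lt (- real n))"
      using common[of "\<lambda>n. lt (- real n)"] open_lt by blast
    obtain n where "- f y < real n"
      using reals_Archimedean2 by blast
    with closure_lt[OF y(2) y(1), of n] show False by simp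
  qed
  then obtain b where b: "x \<notin> closure (lt b)" by blast
  have ev_le: "\<forall>\<^sub>F y in at x. f y \<le> a" if "x \<notin> closure (gt a)" for a
    using that unfolding eventually_at_topological
    by (intro exI[of _ "- closure (gt a)"]) (use closure_subset[of "gt a"] in \<open>auto simp: gt_def not_less\<close>)
  have ev_ge: "\<forall>\<^sub>F y in at x. f y \<ge> a" if "x \<notin> closure (lt a)" for a
    using that unfolding eventually_at_topological
    by (intro exI[of _ "- closure (lt a)"]) (use closure_subset[of "lt a"] in \<open>auto simp: lt_def not_less\<close>)
  have nontriv: "at x \<noteq> bot"
    using x open_imp_gdelta_in[of euclidean "{x}"] by (auto simp: at_eq_bot_iff)
  \<comment> \<open>These are the eventual upper bounds of \<open>f\<close> at \<open>x\<close>, so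
    \<open>Inf B\<close> is the limit superior.\<close>
  define B where "B = {a. x \<notin> closure (gt a)}"
  have B_bdd: "bdd_below B"
  proof (rule bdd_belowI)
    fix a assume "a \<in> B"
    then have "\<forall>\<^sub>F y in at x. b \<le> a"
      using ev_le[of a] ev_ge[OF b] by (auto simp: B_def elim: eventually_elim2)
    then show "b \<le> a"
      using nontriv by simp
  qed
  have B_ne: "B \<noteq> {}"
    using u by (auto simp: B_def)
  define l where "l = Inf B"
  have "(f \<longlongrightarrow> l) (at x)"
  proof (rule order_tendstoI)
    fix a assume "l < a"
    then obtain c where "c \<in> B" "c < a"
      using cInf_less_iff[OF B_ne B_bdd] by (auto simp: l_def)
    then show "\<forall>\<^sub>F y in at x. f y < a"
      using ev_le[of c] by (auto simp: B_def elim!: eventually_mono)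
  next
    fix a assume "a < l"
    \<comment> \<open>Two intermediate levels are used: \<open>c' < l\<close> puts \<open>x\<close>
      in the closure of \<open>gt c'\<close>, and absence of oscillation between \<open>c\<close>
      and \<open>c'\<close> then gives \<open>f \<ge> c > a\<close> near \<open>x\<close>.\<close>
    define c where "c = (a + l) / 2"
    define c' where "c' = (c + l) / 2"
    have c: "a < c" "c < c'" "c' < l"
      using \<open>a < l\<close> by (auto simp: c_def c'_def)
    have "c' \<notin> B"
      using cInf_lower[OF _ B_bdd, of c'] c(3) by (auto simp: l_def)
    then have "x \<notin> closure (lt c)"
      using no_oscillation[OF c(2)] by (auto simp: B_def)
    from ev_ge[OF this] show "\<forall>\<^sub>F y in at x. f y > a"
      by eventually_elim (use c(1) in simp)
  qed
  then show ?thesis ..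
qed

text \<open>A left translation carries a precompact open set to a neighbourhood of \<open>x\<close>;
  \<open>g\<close> is chosen with \<open>g + x = w\<close>.\<close>

lemma locally_precompact_totally_bounded_nbhd:
  fixes x :: "'a::topological_group_add"
  assumes "locally_precompact TYPE('a::topological_group_add)"
  shows "\<exists>W. totally_bounded W \<and> open W \<and> x \<in> W"
proof -
  obtain W0 :: "'a set" and w where W0: "open W0" "w \<in> W0" "precompact W0"
    using assms unfolding locally_precompact_def by blast
  define g where "g = w + - x"
  define W where "W = {y. g + y \<in> W0}"
  have "totally_bounded W"
    unfolding totally_bounded_def
  proof (intro allI impI)
    fix V :: "'a set" assume V: "open V \<and> 0 \<in> V"
    have "\<exists>S\<subseteq>W0. finite S \<and> W0 \<subseteq> (S + V) \<inter> (V + S)"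
      using W0(3)[unfolded precompact_def, rule_format, OF V] .
    then obtain S where S: "finite S" "W0 \<subseteq> S + V"
      by (elim exE conjE) simp
    have "W \<subseteq> ((+) (- g) ` S) + V"
    proof
      fix y assume "y \<in> W"
      then obtain s v where "s \<in> S" "v \<in> V" "g + y = s + v"
        using S(2) unfolding W_def by (blast elim: set_plus_elim)
      then have "y = (- g + s) + v"
        by (metis add.assoc minus_add_cancel)
      then show "y \<in> ((+) (- g) ` S) + V"
        using \<open>s \<in> S\<close> \<open>v \<in> V\<close> by (metis imageI set_plus_intro)
    qed
    then show "\<exists>S. finite S \<and> W \<subseteq> S + V"
      using S(1) by blast
  qed
  moreover have "open W"
    unfolding W_def by (rule open_translation_vimage(1)[OF W0(1)])
  moreover have "x \<in> W"
    using W0(2) by (simp add: W_def g_def)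
  ultimately show ?thesis
    by blast
qed

text \<open>Otherwise all coordinates of a closed embedding of \<open>- {x}\<close> converge at
  \<open>x\<close>. The limit \<open>p\<close> is in the closed set \<open>C\<close>, so applying
  \<open>d\<close> shows that points tending to \<open>x\<close> also tend to \<open>d p\<close>,
  which differs from \<open>x\<close>; this contradicts the Hausdorff property.\<close>

lemma realcompact_complement_imp_gdelta:
  fixes x :: "'a::{topological_group_add, t2_space}"
  assumes lp: "locally_precompact TYPE('a::{topological_group_add, t2_space})"
    and rc: "realcompact_space (top_of_set (- {x}))"
  shows "gdelta_in euclidean {x}"
proof (rule ccontr)
  assume x: "\<not> gdelta_in euclidean {x}"
  obtain W where W: "totally_bounded W" "open W" "x \<in> W"
    using locally_precompact_totally_bounded_nbhd[OF lp] by blast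
  obtain I :: "('a \<Rightarrow> real) set" and C e d where C: "closedin (powertop_real I) C"
    and ed: "homeomorphic_maps (top_of_set (- {x})) (subtopology (powertop_real I) C) e d"
    using rc unfolding realcompact_space_def homeomorphic_space_def by blast
  have e_C: "e y \<in> C" "e y \<in> topspace (powertop_real I)" if "y \<noteq> x" for y
    using ed that unfolding homeomorphic_maps_def continuous_map_def by auto
  have "continuous_on (- {x}) (\<lambda>y. e y i)" if "i \<in> I" for i
  proof -
    have "continuous_map (top_of_set (- {x})) (powertop_real I) e"
      using ed by (auto simp: homeomorphic_maps_def continuous_map_in_subtopology)
    then show ?thesis
      using that by (simp add: continuous_map_componentwise)
  qed
  then have "\<forall>i\<in>I. \<exists>l. ((\<lambda>y. e y i) \<longlongrightarrow> l) (at x)"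
    by (intro ballI tendsto_at_non_gdelta_point[OF W x])
  then obtain l where l: "\<forall>i\<in>I. ((\<lambda>y. e y i) \<longlongrightarrow> l i) (at x)"
    by (rule bchoice[THEN exE])
  have nontriv: "at x \<noteq> bot"
    using x open_imp_gdelta_in[of euclidean "{x}"] by (auto simp: at_eq_bot_iff)
  have ev: "\<forall>\<^sub>F y in at x. y \<noteq> x"
    by (simp add: eventually_at_filter)
  define p where "p = restrict l I"
  have lim: "limitin (powertop_real I) e p (at x)"
    unfolding limitin_componentwise
  proof (intro conjI ballI)
    show "\<forall>\<^sub>F y in at x. e y \<in> topspace (powertop_real I)"
      using ev by eventually_elim (rule e_C)
  qed (use l in \<open>auto simp: p_def\<close>)
  have ev_C: "\<forall>\<^sub>F y in at x. e y \<in> C"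
    using ev by eventually_elim (rule e_C)
  have "p \<in> C"
    by (rule limitin_closedin[OF lim C ev_C nontriv])
  then have lim_C: "limitin (subtopology (powertop_real I) C) e p (at x)"
    using lim ev_C by (simp add: limitin_subtopology)
  have "limitin (top_of_set (- {x})) (d \<circ> e) (d p) (at x)"
    using ed by (intro continuous_map_limit[OF _ lim_C]) (simp add: homeomorphic_maps_def)
  then have dp: "((d \<circ> e) \<longlongrightarrow> d p) (at x)" "d p \<noteq> x"
    by (auto simp: limitin_subtopology)
  have "\<forall>\<^sub>F y in at x. (d \<circ> e) y = y"
    using ev by eventually_elim (use ed in \<open>auto simp: homeomorphic_maps_def\<close>)
  from tendsto_cong[OF this] dp(1) have "((\<lambda>y. y) \<longlongrightarrow> d p) (at x)"
    by (simp add: o_def)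
  then have "d p = x"
    using nontriv by (intro tendsto_unique[OF _ _ tendsto_ident_at])
  with dp(2) show False ..
qed

section \<open>Equivalence of the five conditions\<close>

theorem theorem3p5:
  assumes "locally_precompact TYPE('a::{topological_group_add, t2_space})"
  shows
    "(hereditarily_realcompact_space (euclidean :: 'a topology)
        \<longleftrightarrow> countable_pseudocharacter (euclidean :: 'a topology)
            \<and> \<not> ulam_measurable (card_of (UNIV :: 'a set)))
     \<and> (countable_pseudocharacter (euclidean :: 'a topology)
            \<and> \<not> ulam_measurable (card_of (UNIV :: 'a set))
        \<longleftrightarrow> countable_pseudocharacter (euclidean :: 'a topology)
            \<and> \<not> ulam_measurable (precompactness_index (UNIV :: 'a set)))
     \<and> (countable_pseudocharacter (euclidean :: 'a topology)
            \<and> \<not> ulam_measurable (precompactness_index (UNIV :: 'a set))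
        \<longleftrightarrow> (\<exists>T. coarser_topology T (euclidean :: 'a topology)
                \<and> homogeneous_space T \<and> metrizable_space T)
            \<and> \<not> ulam_measurable (card_of (UNIV :: 'a set)))
     \<and> ((\<exists>T. coarser_topology T (euclidean :: 'a topology)
                \<and> homogeneous_space T \<and> metrizable_space T)
            \<and> \<not> ulam_measurable (card_of (UNIV :: 'a set))
        \<longleftrightarrow> (\<exists>T. coarser_topology T (euclidean :: 'a topology)
                \<and> homogeneous_space T \<and> metrizable_space T)
            \<and> \<not> ulam_measurable (precompactness_index (UNIV :: 'a set)))"
proof -
  let ?hrc = "hereditarily_realcompact_space (euclidean :: 'a topology)"
  let ?cps = "countable_pseudocharacter (euclidean :: 'a topology)"
  let ?met = "\<exists>T. coarser_topology T (euclidean :: 'a topology) \<and> homogeneous_space T \<and>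
    metrizable_space T"
  let ?G = "ulam_measurable |UNIV :: 'a set|"
  let ?ip = "ulam_measurable (precompactness_index (UNIV :: 'a set))"
  have hrc_cps: "?cps" if ?hrc
    unfolding countable_pseudocharacter_def
  proof
    fix x :: 'a
    have "realcompact_space (subtopology euclidean (- {x}))"
      using that unfolding hereditarily_realcompact_space_def by (elim allE[of _ "- {x}"] impE) simp_all
    then show "gdelta_in euclidean {x}"
      by (rule realcompact_complement_imp_gdelta[OF assms])
  qed
  have hrc_G: "\<not> ?G" if ?hrc
  proof -
    have "realcompact_space (subtopology euclidean (UNIV :: 'a set))"
      using that unfolding hereditarily_realcompact_space_def by (elim allE[of _ UNIV] impE) simp_all
    then show ?thesis
      using realcompact_imp_not_ulam_measurable[of "euclidean :: 'a topology"] hrc_cps[OF that]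
      by simp
  qed
  have G_hrc: ?hrc if "?cps" "\<not> ?G"
    unfolding hereditarily_realcompact_space_def using realcompact_subspace[OF that] by simp
  have i_ii: "?hrc \<longleftrightarrow> ?cps \<and> \<not> ?G"
    using hrc_cps hrc_G G_hrc by (intro iffI conjI) simp_all
  have ii_iii: "?cps \<and> \<not> ?G \<longleftrightarrow> ?cps \<and> \<not> ?ip"
    using not_ulam_measurable_precompactness_index[where 'a = 'a]
      not_ulam_measurable_UNIV[where 'a = 'a] by (intro iffI conjI) simp_all
  have met_cps: "?met \<longleftrightarrow> ?cps"
  proof
    assume ?met
    then show "?cps"
      by (elim exE conjE) (rule coarser_metrizable_imp_countable_pseudocharacter)
  qed (rule countable_pseudocharacter_imp_coarser_metrizable)
  show ?thesis
    unfolding met_cps i_ii ii_iii by simp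
qed

end
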